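(* Let $(R,\mathfrak m)$ be a Noetherian local ring and let $I$ be an $\mathfrak m$-primary ideal of $R$ that is not a complete intersection. If $c\in R$ is an element such that $c\cdot H_1(I)=0$ and $c\in I:\mathfrak m$, then $c\in\overline{I}$.
   Context: $H_i(I)$ denotes the $i$-th homology module of the Koszul complex built on a minimal generating set of $I$. $\overline{I}$ denotes the integral closure of the ideal $I$. An ideal $I$ of a Noetherian local ring is called a complete intersection if its minimal number of generators equals its height; for an $\mathfrak m$-primary ideal this means that $I$ can be generated by $\dim R$ elements. $I:\mathfrak m=\{r\in R: r\mathfrak m\subseteq I\}$. *)

theory Defs
  imports "HOL-Algebra.Algebra" "HOL-Library.Extended_Nat"
begin

section \<open>Noetherian local rings and their ideals\<close>

locale noetherian_local_ring = cring R + noetherian_ring R for R (structure) and \<mm> +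
  assumes maximal: "maximalideal \<mm> R"
    and unique_maximal: "maximalideal J R \<Longrightarrow> J = \<mm>"

definition radical :: "('a, 'b) ring_scheme \<Rightarrow> 'a set \<Rightarrow> 'a set" where
  "radical R I = {r \<in> carrier R. \<exists>n::nat. r [^]\<^bsub>R\<^esub> n \<in> I}"

definition primary_ideal :: "('a, 'b) ring_scheme \<Rightarrow> 'a set \<Rightarrow> bool" where
  "primary_ideal R Q \<longleftrightarrow> ideal Q R \<and> Q \<noteq> carrier R \<and>
     (\<forall>a \<in> carrier R. \<forall>b \<in> carrier R. a \<otimes>\<^bsub>R\<^esub> b \<in> Q \<longrightarrow> a \<in> Q \<or> b \<in> radical R Q)"

definition primary_to :: "('a, 'b) ring_scheme \<Rightarrow> 'a set \<Rightarrow> 'a set \<Rightarrow> bool" where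
  "primary_to R P Q \<longleftrightarrow> primary_ideal R Q \<and> radical R Q = P"

definition colon_ideal :: "('a, 'b) ring_scheme \<Rightarrow> 'a set \<Rightarrow> 'a set \<Rightarrow> 'a set" where
  "colon_ideal R I J = {r \<in> carrier R. \<forall>x \<in> J. r \<otimes>\<^bsub>R\<^esub> x \<in> I}"

text \<open>The powers \<open>I\<^sup>i\<close> are taken in the semiring of ideals, whose product is the product of
  ideals and whose unit is the whole ring.\<close>

definition integral_closure :: "('a, 'b) ring_scheme \<Rightarrow> 'a set \<Rightarrow> 'a set" where
  "integral_closure R I = {r \<in> carrier R. \<exists>n::nat. \<exists>a. n \<ge> 1 \<and>
     (\<forall>i \<in> {1..n}. a i \<in> I [^]\<^bsub>ideals_set R\<^esub> i) \<and>
     r [^]\<^bsub>R\<^esub> n \<oplus>\<^bsub>R\<^esub> (\<Oplus>\<^bsub>R\<^esub>i\<in>{1..n}. a i \<otimes>\<^bsub>R\<^esub> r [^]\<^bsub>R\<^esub> (n - i)) = \<zero>\<^bsub>R\<^esub>}"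

section \<open>Height, number of generators, complete intersections\<close>

definition prime_height :: "('a, 'b) ring_scheme \<Rightarrow> 'a set \<Rightarrow> enat" where
  "prime_height R p = Sup {enat n | n. \<exists>P :: nat \<Rightarrow> 'a set.
     (\<forall>i \<le> n. primeideal (P i) R) \<and> (\<forall>i < n. P i \<subset> P (Suc i)) \<and> P n = p}"

definition ideal_height :: "('a, 'b) ring_scheme \<Rightarrow> 'a set \<Rightarrow> enat" where
  "ideal_height R I = Inf {prime_height R p | p. primeideal p R \<and> I \<subseteq> p}"

definition min_num_gens :: "('a, 'b) ring_scheme \<Rightarrow> 'a set \<Rightarrow> nat" where
  "min_num_gens R I =
     (LEAST n. \<exists>A \<subseteq> carrier R. finite A \<and> card A = n \<and> I = Idl\<^bsub>R\<^esub> A)"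

definition complete_intersection :: "('a, 'b) ring_scheme \<Rightarrow> 'a set \<Rightarrow> bool" where
  "complete_intersection R I \<longleftrightarrow> enat (min_num_gens R I) = ideal_height R I"

text \<open>Minimality is with respect to inclusion; over a local ring, for a finitely generated ideal,
  this agrees with minimality of the cardinality. The list fixes an ordering of the generators.\<close>

definition minimal_generators :: "('a, 'b) ring_scheme \<Rightarrow> 'a set \<Rightarrow> 'a list \<Rightarrow> bool" where
  "minimal_generators R I xs \<longleftrightarrow> distinct xs \<and> set xs \<subseteq> carrier R \<and> I = Idl\<^bsub>R\<^esub> (set xs) \<and>
     (\<forall>A. A \<subset> set xs \<longrightarrow> I \<noteq> Idl\<^bsub>R\<^esub> A)"

section \<open>Koszul homology\<close>

text \<open>Modules are records that extend rings, so they carry the fields \<open>mult\<close> and \<open>one\<close>,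
  which play no role for a module and are left undefined below.\<close>

definition quotient_module :: "('r, 'm) module \<Rightarrow> 'm set \<Rightarrow> ('r, 'm set) module" where
  "quotient_module M N =
     \<lparr>carrier = a_rcosets\<^bsub>M\<^esub> N, monoid.mult = undefined, one = undefined,
      ring.zero = N, ring.add = set_add M,
      smult = (\<lambda>a C. \<Union>x\<in>C. N +>\<^bsub>M\<^esub> (a \<odot>\<^bsub>M\<^esub> x))\<rparr>"

text \<open>The degree \<open>p\<close> part of the Koszul complex on \<open>x\<^sub>0, \<dots>, x\<^bsub>n-1\<^esub>\<close> is the \<open>p\<close>-th exterior power
  of the free module with basis \<open>e\<^sub>0, \<dots>, e\<^bsub>n-1\<^esub>\<close>. It is free on the elements
  \<open>e\<^sub>S = e\<^bsub>s 1\<^esub> \<and> \<dots> \<and> e\<^bsub>s p\<^esub>\<close> for \<open>S = {s 1 < \<dots> < s p}\<close>; an element is represented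
  by its family of coordinates, indexed by \<open>S\<close>.\<close>

definition koszul_index :: "nat \<Rightarrow> nat \<Rightarrow> nat set set" where
  "koszul_index n p = {S. S \<subseteq> {..<n} \<and> card S = p}"

definition koszul_module ::
    "('a, 'b) ring_scheme \<Rightarrow> nat \<Rightarrow> nat \<Rightarrow> ('a, nat set \<Rightarrow> 'a) module" where
  "koszul_module R n p =
     \<lparr>carrier = koszul_index n p \<rightarrow>\<^sub>E carrier R, monoid.mult = undefined, one = undefined,
      ring.zero = (\<lambda>S\<in>koszul_index n p. \<zero>\<^bsub>R\<^esub>),
      ring.add = (\<lambda>f g. \<lambda>S\<in>koszul_index n p. f S \<oplus>\<^bsub>R\<^esub> g S),
      smult = (\<lambda>a f. \<lambda>S\<in>koszul_index n p. a \<otimes>\<^bsub>R\<^esub> f S)\<rparr>"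

text \<open>\<open>koszul_diff R xs p\<close> is the differential from degree \<open>p + 1\<close> to degree \<open>p\<close>. It maps \<open>e\<^sub>S\<close> to
  the sum over \<open>j \<in> S\<close> of \<open>(-1)\<^sup>k x\<^sub>j e\<^bsub>S - {j}\<^esub>\<close>, where \<open>k\<close> is the number of elements of \<open>S\<close> that
  are less than \<open>j\<close>. The coordinate of the image at \<open>T\<close> therefore collects the contributions
  of the sets \<open>S = T \<union> {j}\<close> with \<open>j \<notin> T\<close>.\<close>

definition koszul_diff ::
    "('a, 'b) ring_scheme \<Rightarrow> 'a list \<Rightarrow> nat \<Rightarrow> (nat set \<Rightarrow> 'a) \<Rightarrow> (nat set \<Rightarrow> 'a)" where
  "koszul_diff R xs p f =
     (\<lambda>T\<in>koszul_index (length xs) p.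
        \<Oplus>\<^bsub>R\<^esub>j\<in>{..<length xs} - T.
          (\<ominus>\<^bsub>R\<^esub> \<one>\<^bsub>R\<^esub>) [^]\<^bsub>R\<^esub> card {k \<in> T. k < j} \<otimes>\<^bsub>R\<^esub> (xs ! j) \<otimes>\<^bsub>R\<^esub> f (insert j T))"

text \<open>The complex vanishes in negative degrees, so in degree \<open>0\<close> everything is a cycle.\<close>

definition koszul_cycles :: "('a, 'b) ring_scheme \<Rightarrow> 'a list \<Rightarrow> nat \<Rightarrow> (nat set \<Rightarrow> 'a) set" where
  "koszul_cycles R xs p = (case p of
       0 \<Rightarrow> carrier (koszul_module R (length xs) 0)
     | Suc q \<Rightarrow> {f \<in> carrier (koszul_module R (length xs) p).
                  koszul_diff R xs q f = \<zero>\<^bsub>koszul_module R (length xs) q\<^esub>})"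

definition koszul_boundaries ::
    "('a, 'b) ring_scheme \<Rightarrow> 'a list \<Rightarrow> nat \<Rightarrow> (nat set \<Rightarrow> 'a) set" where
  "koszul_boundaries R xs p =
     koszul_diff R xs p ` carrier (koszul_module R (length xs) (Suc p))"

definition koszul_homology ::
    "('a, 'b) ring_scheme \<Rightarrow> 'a list \<Rightarrow> nat \<Rightarrow> ('a, (nat set \<Rightarrow> 'a) set) module" where
  "koszul_homology R xs p =
     quotient_module
       ((koszul_module R (length xs) p)\<lparr>carrier := koszul_cycles R xs p\<rparr>)
       (koszul_boundaries R xs p)"

definition annihilates :: "'r \<Rightarrow> ('r, 'm) module \<Rightarrow> bool" where
  "annihilates a M \<longleftrightarrow> (\<forall>x \<in> carrier M. a \<odot>\<^bsub>M\<^esub> x = \<zero>\<^bsub>M\<^esub>)"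

end

theory Submission
  imports Defs
begin

text \<open>Let \<open>x\<^sub>1, \<dots>, x\<^sub>n\<close> be the given generators of \<open>I\<close>. A syzygy is a vector \<open>a\<close> with
  \<open>a\<^sub>1 x\<^sub>1 + \<dots> + a\<^sub>n x\<^sub>n = 0\<close>, and it is a Koszul syzygy if \<open>a = b x\<close> for an alternating matrix \<open>b\<close>.
  Since \<open>H\<^sub>1(I)\<close> is the module of syzygies modulo the Koszul ones, \<open>c\<close> multiplies every syzygy into a
  Koszul syzygy (\<open>koszul_annihilator_syzygies\<close>).

  Suppose that \<open>c \<in> \<mm>\<close> and \<open>c \<mm> \<subseteq> I \<mm>\<close>. Then \<open>c\<close> is integral over \<open>I\<close> by the determinant trick:
  eliminating generators \<open>g\<^sub>i\<close> of \<open>\<mm>\<close> from the equations \<open>c g\<^sub>i = \<Sum> a\<^sub>i\<^sub>j g\<^sub>j\<close>, with \<open>a\<^sub>i\<^sub>j \<in> I\<close>,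
  produces an expression \<open>s = c\<^sup>d + a\<^sub>1 c\<^sup>d\<^sup>-\<^sup>1 + \<dots> + a\<^sub>d\<close>, with \<open>a\<^sub>i \<in> I\<^sup>i\<close>, that kills \<open>\<mm>\<close>,
  and \<open>s c = 0\<close> is an equation of integral dependence (\<open>integral_closureI\<close>).

  In all other cases \<open>I\<close> is a complete intersection. If \<open>c\<close> is a unit, then \<open>H\<^sub>1(I) = 0\<close>, and this
  forces \<open>\<mm>\<close> to have height at least \<open>n\<close>. Otherwise there is \<open>y \<in> \<mm>\<close> with \<open>c y \<in> I\<close> and
  \<open>c y \<notin> I \<mm>\<close>, so \<open>c y = \<Sum> r\<^sub>i x\<^sub>i\<close> with some \<open>r\<^sub>p\<close> a unit. Let \<open>J\<close> be generated by the \<open>x\<^sub>i\<close> with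
  \<open>i \<noteq> p\<close>; modulo \<open>J\<close>, the elements \<open>c y\<close> and \<open>x\<^sub>p\<close> agree up to a unit. The \<open>p\<close>-th coordinate of a Koszul
  syzygy lies in \<open>J\<close>, so \<open>v c y \<in> J\<close> implies \<open>v c \<in> J\<close>. Consequently no power of \<open>y\<close> lies in \<open>J\<close>, and some
  prime \<open>P \<noteq> \<mm>\<close> contains \<open>J\<close> but not \<open>y\<close>. It does not contain \<open>c\<close> either, for otherwise it
  would contain \<open>x\<^sub>p\<close> and hence \<open>I\<close>. Extended by \<open>0\<close>, a syzygy \<open>a\<close> of \<open>J\<close> is a syzygy of
  \<open>I\<close>, and reading off \<open>c a\<close> gives \<open>c a = x\<^sub>p b + k\<close> where \<open>b\<close> is a syzygy and \<open>k\<close> a Koszul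
  syzygy of \<open>J\<close>. As \<open>J\<close> annihilates \<open>H\<^sub>1(J)\<close>, this says \<open>c H\<^sub>1(J) = y c H\<^sub>1(J)\<close>, and \<open>c H\<^sub>1(J) = 0\<close> by
  Nakayama's lemma. So \<open>H\<^sub>1(J)\<close> vanishes at \<open>P\<close>, the height of \<open>P\<close> is at least \<open>n - 1\<close>, and the height
  of \<open>\<mm>\<close> is at least \<open>n\<close> (\<open>complete_intersection_of_colon\<close>).

  Two bounds on chains of primes remain. If \<open>H\<^sub>1(x\<^sub>1, \<dots>, x\<^sub>n)\<close> vanishes at a prime \<open>P\<close> that contains the
  \<open>x\<^sub>i\<close>, there is a chain of length \<open>n\<close> below \<open>P\<close> (\<open>prime_chain_of_locally_koszul\<close>). Conversely no
  chain that ends in \<open>\<mm>\<close> is longer than the number of generators of an \<open>\<mm>\<close>-primary ideal, which is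
  Krull's height theorem (\<open>prime_chain_length_le\<close>). Together they give equality of the height and the least
  number of generators.

  Rings of fractions do not occur: a statement about the localization at a prime \<open>P\<close> is expressed by
  multipliers \<open>s \<notin> P\<close>. Nakayama's lemma in this form and the determinant trick are the
  same elimination argument (\<open>elimination\<close>).\<close>

section \<open>Elimination in modules\<close>

text \<open>The linear combinations of a list of module elements with coefficients in \<open>C\<close>. Recursion
  along the list exposes the coefficient of the first element, which is the one that an elimination
  step removes.\<close>

primrec lin_combs :: "('r, 'm, 'c) module_scheme \<Rightarrow> 'r set \<Rightarrow> 'm list \<Rightarrow> 'm set" where
  "lin_combs M C [] = {\<zero>\<^bsub>M\<^esub>}"
| "lin_combs M C (g # gs) = {a \<odot>\<^bsub>M\<^esub> g \<oplus>\<^bsub>M\<^esub> w | a w. a \<in> C \<and> w \<in> lin_combs M C gs}"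

context module
begin

lemma lin_combs_closed:
  "C \<subseteq> carrier R \<Longrightarrow> set gs \<subseteq> carrier M \<Longrightarrow> lin_combs M C gs \<subseteq> carrier M"
  by (induction gs) auto

lemma lin_combs_add:
  assumes "C \<subseteq> carrier R" "set gs \<subseteq> carrier M"
    and "\<And>a b. a \<in> C \<Longrightarrow> b \<in> C \<Longrightarrow> a \<oplus> b \<in> C"
    and "v \<in> lin_combs M C gs" "w \<in> lin_combs M C gs"
  shows "v \<oplus>\<^bsub>M\<^esub> w \<in> lin_combs M C gs"
  using assms(2,4,5)
proof (induction gs arbitrary: v w)
  case (Cons g gs)
  obtain a v' where v: "v = a \<odot>\<^bsub>M\<^esub> g \<oplus>\<^bsub>M\<^esub> v'" "a \<in> C" "v' \<in> lin_combs M C gs"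
    using Cons.prems by auto
  obtain b w' where w: "w = b \<odot>\<^bsub>M\<^esub> g \<oplus>\<^bsub>M\<^esub> w'" "b \<in> C" "w' \<in> lin_combs M C gs"
    using Cons.prems by auto
  have c: "v' \<in> carrier M" "w' \<in> carrier M" "a \<in> carrier R" "b \<in> carrier R" "g \<in> carrier M"
    using v w lin_combs_closed[OF assms(1), of gs] Cons.prems assms(1) by auto
  have "v \<oplus>\<^bsub>M\<^esub> w = (a \<oplus> b) \<odot>\<^bsub>M\<^esub> g \<oplus>\<^bsub>M\<^esub> (v' \<oplus>\<^bsub>M\<^esub> w')"
    using c by (simp add: v w smult_l_distr M.a_ac)
  then show ?case
    using Cons.IH[OF _ v(3) w(3)] Cons.prems assms(3)[OF v(2) w(2)] by auto
qed auto

lemma lin_combs_smult: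
  assumes "C \<subseteq> carrier R" "set gs \<subseteq> carrier M" "r \<in> carrier R"
    and "\<And>a. a \<in> C \<Longrightarrow> r \<otimes> a \<in> D"
    and "w \<in> lin_combs M C gs"
  shows "r \<odot>\<^bsub>M\<^esub> w \<in> lin_combs M D gs"
  using assms(2,5)
proof (induction gs arbitrary: w)
  case (Cons g gs)
  obtain a v where v: "w = a \<odot>\<^bsub>M\<^esub> g \<oplus>\<^bsub>M\<^esub> v" "a \<in> C" "v \<in> lin_combs M C gs"
    using Cons.prems by auto
  have c: "v \<in> carrier M" "a \<in> carrier R" "g \<in> carrier M"
    using v lin_combs_closed[OF assms(1), of gs] Cons.prems assms(1) by auto
  have "r \<odot>\<^bsub>M\<^esub> w = (r \<otimes> a) \<odot>\<^bsub>M\<^esub> g \<oplus>\<^bsub>M\<^esub> r \<odot>\<^bsub>M\<^esub> v"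
    using c assms(3) by (simp add: v smult_r_distr smult_assoc1)
  then show ?case
    using Cons.IH[OF _ v(3)] Cons.prems assms(4)[OF v(2)] by auto
qed (use assms(3) in auto)

lemma lin_combs_mono: "C \<subseteq> D \<Longrightarrow> lin_combs M C gs \<subseteq> lin_combs M D gs"
  by (induction gs) (simp, fastforce)

lemma lin_combs_zero:
  "\<zero> \<in> C \<Longrightarrow> C \<subseteq> carrier R \<Longrightarrow> set gs \<subseteq> carrier M \<Longrightarrow> \<zero>\<^bsub>M\<^esub> \<in> lin_combs M C gs"
proof (induction gs)
  case (Cons g gs)
  have "\<zero>\<^bsub>M\<^esub> = \<zero> \<odot>\<^bsub>M\<^esub> g \<oplus>\<^bsub>M\<^esub> \<zero>\<^bsub>M\<^esub>" using Cons.prems by simp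
  moreover have "\<zero>\<^bsub>M\<^esub> \<in> lin_combs M C gs" using Cons by simp
  ultimately show ?case using Cons.prems(1) unfolding lin_combs.simps by blast
qed simp

lemma lin_combs_generator:
  assumes "C \<subseteq> carrier R" "\<zero> \<in> C" "set gs \<subseteq> carrier M" "g \<in> set gs" "a \<in> C"
  shows "a \<odot>\<^bsub>M\<^esub> g \<in> lin_combs M C gs"
  using assms(3,4)
proof (induction gs)
  case (Cons h gs)
  show ?case
  proof (cases "g = h")
    case True
    have "a \<odot>\<^bsub>M\<^esub> g = a \<odot>\<^bsub>M\<^esub> h \<oplus>\<^bsub>M\<^esub> \<zero>\<^bsub>M\<^esub>" using Cons.prems True assms by auto
    then show ?thesis using lin_combs_zero[of C gs] assms Cons.prems by auto
  next
    case False
    then have *: "a \<odot>\<^bsub>M\<^esub> g \<in> lin_combs M C gs" using Cons by auto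
    then have "a \<odot>\<^bsub>M\<^esub> g = \<zero> \<odot>\<^bsub>M\<^esub> h \<oplus>\<^bsub>M\<^esub> a \<odot>\<^bsub>M\<^esub> g"
      using Cons.prems assms(1) lin_combs_closed[of C gs] by auto
    with * show ?thesis using assms(2) by auto
  qed
qed simp

lemma lin_combs_smult_submodule:
  assumes N: "submodule N R M" and "C \<subseteq> carrier R" "set gs \<subseteq> carrier M" "s \<in> carrier R"
    and "\<forall>g\<in>set gs. s \<odot>\<^bsub>M\<^esub> g \<in> N" and "w \<in> lin_combs M C gs"
  shows "s \<odot>\<^bsub>M\<^esub> w \<in> N"
  using assms(3,5,6)
proof (induction gs arbitrary: w)
  case Nil
  then show ?case using assms(4) submoduleE[OF N]
    by (metis lin_combs.simps(1) equals0I smult_l_null smult_r_null R.zero_closed singletonD subsetD)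
next
  case (Cons g gs)
  obtain a v where v: "w = a \<odot>\<^bsub>M\<^esub> g \<oplus>\<^bsub>M\<^esub> v" "a \<in> C" "v \<in> lin_combs M C gs"
    using Cons.prems by auto
  have c: "v \<in> carrier M" "a \<in> carrier R" "g \<in> carrier M"
    using v lin_combs_closed[OF assms(2), of gs] Cons.prems assms(2) by auto
  have "s \<odot>\<^bsub>M\<^esub> w = a \<odot>\<^bsub>M\<^esub> (s \<odot>\<^bsub>M\<^esub> g) \<oplus>\<^bsub>M\<^esub> s \<odot>\<^bsub>M\<^esub> v"
    using c assms(4) by (simp add: v smult_r_distr smult_assoc1[symmetric] m_comm)
  then show ?case
    using Cons.IH[OF _ _ v(3)] Cons.prems submoduleE(4,5)[OF N] c by auto
qed

lemma lin_combs_append: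
  assumes "set gs \<subseteq> carrier M" "set hs \<subseteq> carrier M" "C \<subseteq> carrier R"
    and "v \<in> lin_combs M C gs" "w \<in> lin_combs M C hs"
  shows "v \<oplus>\<^bsub>M\<^esub> w \<in> lin_combs M C (gs @ hs)"
proof -
  have wM: "w \<in> carrier M" using lin_combs_closed[OF assms(3,2)] assms(5) by blast
  show ?thesis using assms(1,4)
  proof (induction gs arbitrary: v)
    case Nil
    then show ?case using assms(5) wM by simp
  next
    case (Cons g gs)
    obtain a u where v: "v = a \<odot>\<^bsub>M\<^esub> g \<oplus>\<^bsub>M\<^esub> u" "a \<in> C" "u \<in> lin_combs M C gs"
      using Cons.prems by auto
    have "u \<in> carrier M" "a \<odot>\<^bsub>M\<^esub> g \<in> carrier M"
      using v lin_combs_closed[OF assms(3), of gs] Cons.prems assms(3) by auto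
    then have "v \<oplus>\<^bsub>M\<^esub> w = a \<odot>\<^bsub>M\<^esub> g \<oplus>\<^bsub>M\<^esub> (u \<oplus>\<^bsub>M\<^esub> w)"
      using wM by (simp add: v M.a_assoc)
    then show ?case using Cons.IH[OF _ v(3)] Cons.prems v(2) by auto
  qed
qed

lemma lin_combs_subset_submodule:
  assumes "submodule L R M" "set gs \<subseteq> L" "C \<subseteq> carrier R"
  shows "lin_combs M C gs \<subseteq> L"
proof -
  note L = submoduleE[OF assms(1)]
  have gs: "set gs \<subseteq> carrier M" using assms(2) L(1) by blast
  have "\<one> \<odot>\<^bsub>M\<^esub> w \<in> L" if "w \<in> lin_combs M C gs" for w
    using assms(2) L(4)[OF R.one_closed]
    by (intro lin_combs_smult_submodule[OF assms(1,3) gs _ _ that]) auto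
  moreover have "lin_combs M C gs \<subseteq> carrier M" using lin_combs_closed[OF assms(3) gs] .
  ultimately show ?thesis by (metis smult_one subset_iff)
qed

lemma lin_combs_map_smult:
  assumes "set gs \<subseteq> carrier M" "C \<subseteq> carrier R" "c \<in> carrier R" "w \<in> lin_combs M C gs"
  shows "c \<odot>\<^bsub>M\<^esub> w \<in> lin_combs M C (map (\<lambda>g. c \<odot>\<^bsub>M\<^esub> g) gs)"
  using assms(1,4)
proof (induction gs arbitrary: w)
  case Nil
  then show ?case using assms(3) by simp
next
  case (Cons g gs)
  obtain a u where w: "w = a \<odot>\<^bsub>M\<^esub> g \<oplus>\<^bsub>M\<^esub> u" "a \<in> C" "u \<in> lin_combs M C gs"
    using Cons.prems by auto
  have "u \<in> carrier M" "a \<in> carrier R" "g \<in> carrier M"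
    using w lin_combs_closed[OF assms(2), of gs] Cons.prems assms(2) by auto
  then have "c \<odot>\<^bsub>M\<^esub> w = a \<odot>\<^bsub>M\<^esub> (c \<odot>\<^bsub>M\<^esub> g) \<oplus>\<^bsub>M\<^esub> c \<odot>\<^bsub>M\<^esub> u"
    using assms(3) by (simp add: w smult_r_distr smult_assoc1[symmetric] m_comm)
  then show ?case using Cons.IH[OF _ w(3)] Cons.prems w(2) by auto
qed

text \<open>Gaussian elimination without division. The sets \<open>S d\<close> consist of elements that are monic of degree \<open>d\<close>
  and \<open>A d\<close> of the elements without leading term, so that a diagonal entry in \<open>S d\<close> stays there when an
  entry in \<open>A d\<close> is subtracted. Each row of the system carries a monic factor on the
  diagonal. The first generator is solved for in its own row, and it is substituted into
  the other rows after these are multiplied by its monic factor \<open>t\<close>; this doubles the degree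
  and leaves a system of the same kind in one generator fewer.\<close>

lemma elimination:
  fixes S A :: "nat \<Rightarrow> 'a set"
  assumes N: "submodule N R M"
    and SR: "\<And>d. S d \<subseteq> carrier R" and AR: "\<And>d. A d \<subseteq> carrier R"
    and one: "\<one> \<in> S 0"
    and SS: "\<And>d e s t. s \<in> S d \<Longrightarrow> t \<in> S e \<Longrightarrow> s \<otimes> t \<in> S (d + e)"
    and SA: "\<And>d e s a. s \<in> S d \<Longrightarrow> a \<in> A e \<Longrightarrow> s \<otimes> a \<in> A (d + e)"
    and AA: "\<And>d e a b. a \<in> A d \<Longrightarrow> b \<in> A e \<Longrightarrow> a \<otimes> b \<in> A (d + e)"
    and A_add: "\<And>d a b. a \<in> A d \<Longrightarrow> b \<in> A d \<Longrightarrow> a \<oplus> b \<in> A d"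
    and S_minus: "\<And>d s a. s \<in> S d \<Longrightarrow> a \<in> A d \<Longrightarrow> s \<ominus> a \<in> S d"
    and gs: "set gs \<subseteq> carrier M"
    and rows: "\<forall>g\<in>set gs. \<exists>s\<in>S d. \<exists>n\<in>N. \<exists>w\<in>lin_combs M (A d) gs. s \<odot>\<^bsub>M\<^esub> g = n \<oplus>\<^bsub>M\<^esub> w"
  shows "\<exists>e. \<exists>s\<in>S e. \<forall>g\<in>set gs. s \<odot>\<^bsub>M\<^esub> g \<in> N"
  using gs rows
proof (induction gs arbitrary: d)
  case Nil
  then show ?case using one by auto
next
  case (Cons g gs)
  have NM: "N \<subseteq> carrier M" using submoduleE(1)[OF N] .
  have g: "g \<in> carrier M" and gs: "set gs \<subseteq> carrier M" using Cons.prems by auto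
  obtain s n a w where s: "s \<in> S d" and n: "n \<in> N" and a: "a \<in> A d"
    and w: "w \<in> lin_combs M (A d) gs" and row: "s \<odot>\<^bsub>M\<^esub> g = n \<oplus>\<^bsub>M\<^esub> (a \<odot>\<^bsub>M\<^esub> g \<oplus>\<^bsub>M\<^esub> w)"
    using Cons.prems by auto
  note in_carrier = subsetD[OF SR] subsetD[OF AR] subsetD[OF NM]
    subsetD[OF lin_combs_closed[OF AR gs]]
  define t where "t = s \<ominus> a"
  have t: "t \<in> S d" using S_minus[OF s a] by (simp add: t_def)
  have tR: "t \<in> carrier R" using in_carrier t by auto
  have c: "s \<in> carrier R" "a \<in> carrier R" "n \<in> carrier M" "w \<in> carrier M"
    using in_carrier s a n w by auto
  \<comment> \<open>the first row, solved for its own generator\<close>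
  have tg: "t \<odot>\<^bsub>M\<^esub> g = n \<oplus>\<^bsub>M\<^esub> w"
  proof -
    have "t \<odot>\<^bsub>M\<^esub> g = s \<odot>\<^bsub>M\<^esub> g \<oplus>\<^bsub>M\<^esub> \<ominus>\<^bsub>M\<^esub> (a \<odot>\<^bsub>M\<^esub> g)"
      using c g by (simp add: t_def a_minus_def smult_l_distr smult_l_minus)
    also have "\<dots> = n \<oplus>\<^bsub>M\<^esub> w"
      unfolding row using c g
      by (simp add: M.a_ac M.r_neg M.r_neg1)
    finally show ?thesis .
  qed
  have "\<forall>h\<in>set gs. \<exists>u\<in>S (d + d). \<exists>n\<in>N. \<exists>w\<in>lin_combs M (A (d + d)) gs. u \<odot>\<^bsub>M\<^esub> h = n \<oplus>\<^bsub>M\<^esub> w"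
  proof
    fix h assume h: "h \<in> set gs"
    then obtain s' n' a' w' where s': "s' \<in> S d" and n': "n' \<in> N" and a': "a' \<in> A d"
      and w': "w' \<in> lin_combs M (A d) gs"
      and row': "s' \<odot>\<^bsub>M\<^esub> h = n' \<oplus>\<^bsub>M\<^esub> (a' \<odot>\<^bsub>M\<^esub> g \<oplus>\<^bsub>M\<^esub> w')"
      using Cons.prems by auto
    have c': "s' \<in> carrier R" "a' \<in> carrier R" "n' \<in> carrier M" "w' \<in> carrier M" "h \<in> carrier M"
      using in_carrier s' a' n' w' gs h by auto
    have "(t \<otimes> s') \<odot>\<^bsub>M\<^esub> h = t \<odot>\<^bsub>M\<^esub> n' \<oplus>\<^bsub>M\<^esub> (a' \<odot>\<^bsub>M\<^esub> (t \<odot>\<^bsub>M\<^esub> g) \<oplus>\<^bsub>M\<^esub> t \<odot>\<^bsub>M\<^esub> w')"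
      using c' tR g by (simp add: smult_assoc1 row' smult_r_distr)
        (simp add: smult_assoc1[symmetric] m_comm)
    also have "\<dots> = (t \<odot>\<^bsub>M\<^esub> n' \<oplus>\<^bsub>M\<^esub> a' \<odot>\<^bsub>M\<^esub> n) \<oplus>\<^bsub>M\<^esub> (a' \<odot>\<^bsub>M\<^esub> w \<oplus>\<^bsub>M\<^esub> t \<odot>\<^bsub>M\<^esub> w')"
      using c c' tR unfolding tg by (simp add: smult_r_distr M.a_ac)
    finally have eq: "(t \<otimes> s') \<odot>\<^bsub>M\<^esub> h =
        (t \<odot>\<^bsub>M\<^esub> n' \<oplus>\<^bsub>M\<^esub> a' \<odot>\<^bsub>M\<^esub> n) \<oplus>\<^bsub>M\<^esub> (a' \<odot>\<^bsub>M\<^esub> w \<oplus>\<^bsub>M\<^esub> t \<odot>\<^bsub>M\<^esub> w')" .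
    have "t \<odot>\<^bsub>M\<^esub> n' \<oplus>\<^bsub>M\<^esub> a' \<odot>\<^bsub>M\<^esub> n \<in> N"
      using submoduleE(4,5)[OF N] c' tR n n' by simp
    moreover have "a' \<odot>\<^bsub>M\<^esub> w \<oplus>\<^bsub>M\<^esub> t \<odot>\<^bsub>M\<^esub> w' \<in> lin_combs M (A (d + d)) gs"
      using lin_combs_smult[OF AR gs c'(2) _ w, of "A (d + d)"] AA[OF a']
        lin_combs_smult[OF AR gs tR _ w', of "A (d + d)"] SA[OF t]
      by (intro lin_combs_add[OF AR gs A_add]) auto
    moreover have "t \<otimes> s' \<in> S (d + d)" using SS[OF t s'] .
    ultimately show "\<exists>u\<in>S (d + d). \<exists>n\<in>N. \<exists>w\<in>lin_combs M (A (d + d)) gs. u \<odot>\<^bsub>M\<^esub> h = n \<oplus>\<^bsub>M\<^esub> w"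
      using eq by blast
  qed
  then obtain e u where u: "u \<in> S e" and ugs: "\<forall>h\<in>set gs. u \<odot>\<^bsub>M\<^esub> h \<in> N"
    using Cons.IH[OF gs] by blast
  have uR: "u \<in> carrier R" using u SR by auto
  have "(u \<otimes> t) \<odot>\<^bsub>M\<^esub> h \<in> N" if "h \<in> set (g # gs)" for h
  proof (cases "h = g")
    case True
    have "(u \<otimes> t) \<odot>\<^bsub>M\<^esub> g = u \<odot>\<^bsub>M\<^esub> n \<oplus>\<^bsub>M\<^esub> u \<odot>\<^bsub>M\<^esub> w"
      using uR tR g c by (simp add: smult_assoc1 tg smult_r_distr)
    then show ?thesis
      using True lin_combs_smult_submodule[OF N AR gs uR ugs w] submoduleE(4,5)[OF N] n uR by auto
  next
    case False
    then have h: "h \<in> set gs" using that by auto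
    then have "(u \<otimes> t) \<odot>\<^bsub>M\<^esub> h = t \<odot>\<^bsub>M\<^esub> (u \<odot>\<^bsub>M\<^esub> h)"
      using uR tR gs by (auto simp: smult_assoc1[symmetric] m_comm)
    then show ?thesis using submoduleE(4)[OF N tR] ugs h by auto
  qed
  then show ?case using SS[OF u t] by blast
qed

text \<open>Nakayama's lemma for the localization at \<open>P\<close>: the complement of \<open>P\<close> and \<open>P\<close> itself serve as monic
  elements and as elements without leading term, in every degree.\<close>

lemma nakayama_at_prime:
  assumes N: "submodule N R M" and P: "primeideal P R"
    and gs: "set gs \<subseteq> carrier M"
    and rows: "\<forall>g\<in>set gs. \<exists>s\<in>carrier R - P. \<exists>n\<in>N. \<exists>w\<in>lin_combs M P gs. s \<odot>\<^bsub>M\<^esub> g = n \<oplus>\<^bsub>M\<^esub> w"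
  shows "\<exists>s\<in>carrier R - P. \<forall>g\<in>set gs. s \<odot>\<^bsub>M\<^esub> g \<in> N"
proof -
  interpret P: primeideal P R by fact
  have one: "\<one> \<in> carrier R - P"
    using P.one_imp_carrier P.I_notcarr by auto
  have "\<exists>e::nat. \<exists>s\<in>carrier R - P. \<forall>g\<in>set gs. s \<odot>\<^bsub>M\<^esub> g \<in> N"
  proof (rule elimination[where S = "\<lambda>_. carrier R - P" and A = "\<lambda>_. P", OF N _ _ one _ _ _ _ _ gs rows])
    fix s a assume s: "s \<in> carrier R - P" and a: "a \<in> P"
    show "s \<ominus> a \<in> carrier R - P"
    proof -
      have "s \<in> P" if "s \<ominus> a \<in> P"
      proof -
        have "(s \<ominus> a) \<oplus> a = s" using s a P.Icarr by (auto simp: a_minus_def R.a_assoc R.l_neg)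
        then show ?thesis using P.a_closed[OF that a] by simp
      qed
      then show ?thesis using s a P.Icarr by auto
    qed
  qed (use P.Icarr P.I_prime P.I_l_closed P.a_closed in auto)
  then show ?thesis by blast
qed

end

section \<open>Rings as modules over themselves\<close>

definition regular_module :: "('a, 'b) ring_scheme \<Rightarrow> ('a, 'a) module" where
  "regular_module R =
     \<lparr>carrier = carrier R, monoid.mult = monoid.mult R, one = one R, ring.zero = ring.zero R,
      ring.add = ring.add R, smult = monoid.mult R\<rparr>"

lemma regular_module_simps [simp]:
  "carrier (regular_module R) = carrier R" "ring.zero (regular_module R) = ring.zero R"
  "ring.add (regular_module R) = ring.add R" "smult (regular_module R) = monoid.mult R"
  by (simp_all add: regular_module_def)

context cring
begin

lemma module_regular_module: "module R (regular_module R)"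
proof (rule moduleI)
  show "abelian_group (regular_module R)"
    by (rule abelian_groupI) (auto simp: a_assoc intro: a_comm l_neg)
qed (auto simp: l_distr r_distr m_assoc is_cring)

lemma submodule_regular_module:
  assumes "ideal I R"
  shows "submodule I R (regular_module R)"
proof -
  interpret I: ideal I R by fact
  interpret M: module R "regular_module R" by (rule module_regular_module)
  show ?thesis
  proof (rule M.submoduleI)
    fix a assume a: "a \<in> I"
    have "\<ominus>\<^bsub>regular_module R\<^esub> a = \<ominus> a"
      using a I.Icarr by (intro M.M.minus_equality) (auto simp: l_neg)
    then show "\<ominus>\<^bsub>regular_module R\<^esub> a \<in> I" using a by simp
  qed (use I.Icarr I.I_l_closed I.a_closed in auto)
qed

lemma lin_combs_regular_eq_Idl:
  assumes "set gs \<subseteq> carrier R"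
  shows "lin_combs (regular_module R) (carrier R) gs = Idl (set gs)"
proof
  interpret M: module R "regular_module R" by (rule module_regular_module)
  have gs: "set gs \<subseteq> carrier (regular_module R)" using assms by simp
  let ?K = "lin_combs (regular_module R) (carrier R) gs"
  have KR: "?K \<subseteq> carrier R" using M.lin_combs_closed[OF _ gs, of "carrier R"] by simp
  have smult: "r \<otimes> a \<in> ?K" if "a \<in> ?K" "r \<in> carrier R" for a r
    using M.lin_combs_smult[OF _ gs that(2) _ that(1), of "carrier R"] that by simp
  have "ideal ?K R"
  proof (rule idealI)
    show "subgroup ?K (add_monoid R)"
    proof (rule add.subgroupI)
      show "?K \<noteq> {}" using M.lin_combs_zero[of "carrier R", OF _ _ gs] by auto
      show "\<ominus> a \<in> ?K" if "a \<in> ?K" for a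
        using smult[OF that, of "\<ominus> \<one>"] that KR by (auto simp: l_minus)
      show "a \<oplus> b \<in> ?K" if "a \<in> ?K" "b \<in> ?K" for a b
        using M.lin_combs_add[OF _ gs _ that] by simp
    qed (use KR in auto)
    show "a \<otimes> r \<in> ?K" if "a \<in> ?K" "r \<in> carrier R" for a r
      using smult[OF that] that KR by (auto simp: m_comm)
  qed (use ring_axioms smult in auto)
  moreover have "set gs \<subseteq> ?K"
  proof
    fix g assume g: "g \<in> set gs"
    then show "g \<in> ?K"
      using M.lin_combs_generator[of "carrier R", OF _ _ gs g one_closed] assms by (simp add: subset_iff)
  qed
  ultimately show "Idl (set gs) \<subseteq> ?K" by (rule genideal_minimal)
next
  interpret I: ideal "Idl (set gs)" R using genideal_ideal[OF assms] .
  have "set hs \<subseteq> Idl (set gs) \<Longrightarrow> lin_combs (regular_module R) (carrier R) hs \<subseteq> Idl (set gs)" for hs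
    by (induction hs) (auto intro!: I.a_closed I.I_l_closed)
  then show "lin_combs (regular_module R) (carrier R) gs \<subseteq> Idl (set gs)"
    using genideal_self[OF assms] by blast
qed

section \<open>Integral elements\<close>

lemma ideal_power:
  assumes "ideal I R"
  shows "ideal (I [^]\<^bsub>ideals_set R\<^esub> (d::nat)) R"
proof -
  interpret S: comm_monoid "ideals_set R" by (rule ideals_set_is_comm_monoid)
  show ?thesis using S.nat_pow_closed[of I d] assms by (simp add: ideals_set_def)
qed

lemma ideal_power_mult:
  assumes "ideal I R" "a \<in> I [^]\<^bsub>ideals_set R\<^esub> (d::nat)" "b \<in> I [^]\<^bsub>ideals_set R\<^esub> (e::nat)"
  shows "a \<otimes> b \<in> I [^]\<^bsub>ideals_set R\<^esub> (d + e)"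
proof -
  interpret S: comm_monoid "ideals_set R" by (rule ideals_set_is_comm_monoid)
  have "I [^]\<^bsub>ideals_set R\<^esub> (d + e) = ideal_prod R (I [^]\<^bsub>ideals_set R\<^esub> d) (I [^]\<^bsub>ideals_set R\<^esub> e)"
    using S.nat_pow_mult[of I d e] assms(1) by (simp add: ideals_set_def)
  then show ?thesis using ideal_prod.prod[OF assms(2,3)] by metis
qed

lemma ideal_power_one: 
  assumes "ideal I R"
  shows "I [^]\<^bsub>ideals_set R\<^esub> (1::nat) = I"
proof -
  interpret S: comm_monoid "ideals_set R" by (rule ideals_set_is_comm_monoid)
  show ?thesis using assms S.nat_pow_eone[of I] by (simp add: ideals_set_def)
qed

end

text \<open>The elements \<open>w c\<^sup>d + a\<^sub>1 c\<^sup>d\<^sup>-\<^sup>1 + \<dots> + a\<^sub>d\<close> with \<open>a\<^sub>i \<in> I\<^sup>i\<close>, written as a Horner scheme. They are the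
  values at \<open>c\<close> of homogeneous polynomials of degree \<open>d\<close> over the Rees algebra of \<open>I\<close> with leading coefficient \<open>w\<close>; degrees and
  leading coefficients are multiplicative.\<close>

primrec forms :: "('a, 'b) ring_scheme \<Rightarrow> 'a set \<Rightarrow> 'a \<Rightarrow> 'a \<Rightarrow> nat \<Rightarrow> 'a set" where
  "forms R I c w 0 = {w}"
| "forms R I c w (Suc d) =
     {a \<oplus>\<^bsub>R\<^esub> c \<otimes>\<^bsub>R\<^esub> b | a b. a \<in> I [^]\<^bsub>ideals_set R\<^esub> Suc d \<and> b \<in> forms R I c w d}"

context cring
begin

lemma forms_closed:
  assumes "ideal I R" "c \<in> carrier R" "w \<in> carrier R"
  shows "forms R I c w d \<subseteq> carrier R"
proof (induction d)
  case (Suc d)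
  have "I [^]\<^bsub>ideals_set R\<^esub> Suc d \<subseteq> carrier R"
    using ideal.Icarr[OF ideal_power[OF assms(1)]] by blast
  with Suc assms show ?case by auto
qed (use assms in auto)

lemma forms_add:
  assumes "ideal I R" "c \<in> carrier R" "v \<in> carrier R" "w \<in> carrier R"
    and "r \<in> forms R I c v d" "s \<in> forms R I c w d"
  shows "r \<oplus> s \<in> forms R I c (v \<oplus> w) d"
  using assms(5,6)
proof (induction d arbitrary: r s)
  case (Suc d)
  interpret I: ideal "I [^]\<^bsub>ideals_set R\<^esub> Suc d" R using ideal_power[OF assms(1)] .
  obtain a b where r: "r = a \<oplus> c \<otimes> b" "a \<in> I [^]\<^bsub>ideals_set R\<^esub> Suc d" "b \<in> forms R I c v d"
    using Suc.prems by auto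
  obtain a' b' where s: "s = a' \<oplus> c \<otimes> b'" "a' \<in> I [^]\<^bsub>ideals_set R\<^esub> Suc d" "b' \<in> forms R I c w d"
    using Suc.prems by auto
  have "a \<in> carrier R" "a' \<in> carrier R" "b \<in> carrier R" "b' \<in> carrier R"
    using r s I.Icarr forms_closed[OF assms(1,2,3)] forms_closed[OF assms(1,2,4)] by auto
  then have "r \<oplus> s = (a \<oplus> a') \<oplus> c \<otimes> (b \<oplus> b')"
    using assms(2) by (simp add: r s r_distr a_ac)
  then show ?case using Suc.IH[OF r(3) s(3)] I.a_closed[OF r(2) s(2)] by auto
qed auto

lemma forms_uminus:
  assumes "ideal I R" "c \<in> carrier R" "w \<in> carrier R" "r \<in> forms R I c w d"
  shows "\<ominus> r \<in> forms R I c (\<ominus> w) d"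
  using assms(4)
proof (induction d arbitrary: r)
  case (Suc d)
  interpret I: ideal "I [^]\<^bsub>ideals_set R\<^esub> Suc d" R using ideal_power[OF assms(1)] .
  obtain a b where r: "r = a \<oplus> c \<otimes> b" "a \<in> I [^]\<^bsub>ideals_set R\<^esub> Suc d" "b \<in> forms R I c w d"
    using Suc.prems by auto
  have "a \<in> carrier R" "b \<in> carrier R"
    using r I.Icarr forms_closed[OF assms(1,2,3)] by auto
  then have "\<ominus> r = \<ominus> a \<oplus> c \<otimes> (\<ominus> b)"
    using assms(2) by (simp add: r minus_add r_minus)
  then show ?case using Suc.IH[OF r(3)] I.a_inv_closed[OF r(2)] by auto
qed auto

lemma ideal_power_subset_forms:
  assumes "ideal I R" "c \<in> carrier R" "0 < d"
  shows "I [^]\<^bsub>ideals_set R\<^esub> d \<subseteq> forms R I c \<zero> d"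
proof -
  have "\<zero> \<in> forms R I c \<zero> d" for d
  proof (induction d)
    case (Suc d)
    interpret I: ideal "I [^]\<^bsub>ideals_set R\<^esub> Suc d" R using ideal_power[OF assms(1)] .
    have "\<zero> = \<zero> \<oplus> c \<otimes> \<zero>" using assms by simp
    then show ?case using Suc I.zero_closed unfolding forms.simps by blast
  qed simp
  moreover obtain k where k: "d = Suc k" using assms(3) by (cases d) auto
  moreover have "a = a \<oplus> c \<otimes> \<zero>" if "a \<in> I [^]\<^bsub>ideals_set R\<^esub> d" for a
    using that assms ideal.Icarr[OF ideal_power] by auto
  ultimately show ?thesis unfolding k forms.simps by blast
qed

lemma ideal_power_mult_forms:
  assumes "ideal I R" "c \<in> carrier R" "w \<in> carrier R" "0 < d"
    and "a \<in> I [^]\<^bsub>ideals_set R\<^esub> d" "r \<in> forms R I c w e"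
  shows "a \<otimes> r \<in> forms R I c \<zero> (d + e)"
  using assms(6)
proof (induction e arbitrary: r)
  case 0
  interpret I: ideal "I [^]\<^bsub>ideals_set R\<^esub> d" R using ideal_power[OF assms(1)] .
  show ?case using 0 I.I_r_closed[OF assms(5,3)] ideal_power_subset_forms[OF assms(1,2,4)] by auto
next
  case (Suc e)
  obtain a' b where r: "r = a' \<oplus> c \<otimes> b" "a' \<in> I [^]\<^bsub>ideals_set R\<^esub> Suc e" "b \<in> forms R I c w e"
    using Suc.prems by auto
  have "a \<in> carrier R" "a' \<in> carrier R" "b \<in> carrier R"
    using r assms(5) ideal.Icarr[OF ideal_power[OF assms(1)]] forms_closed[OF assms(1,2,3)]
    by (blast+)
  then have "a \<otimes> r = a \<otimes> a' \<oplus> c \<otimes> (a \<otimes> b)"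
    using assms(2) by (simp add: r r_distr m_lcomm)
  then show ?case
    using Suc.IH[OF r(3)] ideal_power_mult[OF assms(1,5) r(2)] by auto
qed

lemma forms_mult:
  assumes "ideal I R" "c \<in> carrier R" "v \<in> carrier R" "w \<in> carrier R"
    and "r \<in> forms R I c v d" "s \<in> forms R I c w e"
  shows "r \<otimes> s \<in> forms R I c (v \<otimes> w) (d + e)"
  using assms(5)
proof (induction d arbitrary: r)
  case 0
  have "v \<otimes> s \<in> forms R I c (v \<otimes> w) e" using assms(6)
  proof (induction e arbitrary: s)
    case (Suc e)
    interpret I: ideal "I [^]\<^bsub>ideals_set R\<^esub> Suc e" R using ideal_power[OF assms(1)] .
    obtain a b where s: "s = a \<oplus> c \<otimes> b" "a \<in> I [^]\<^bsub>ideals_set R\<^esub> Suc e" "b \<in> forms R I c w e"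
      using Suc.prems by auto
    have "a \<in> carrier R" "b \<in> carrier R"
      using s I.Icarr forms_closed[OF assms(1,2,4)] by auto
    then have "v \<otimes> s = v \<otimes> a \<oplus> c \<otimes> (v \<otimes> b)"
      using assms(2,3) by (simp add: s r_distr m_lcomm)
    then show ?case using Suc.IH[OF s(3)] I.I_l_closed[OF s(2) assms(3)] by auto
  qed auto
  then show ?case using 0 by simp
next
  case (Suc d)
  obtain a b where r: "r = a \<oplus> c \<otimes> b" "a \<in> I [^]\<^bsub>ideals_set R\<^esub> Suc d" "b \<in> forms R I c v d"
    using Suc.prems by auto
  interpret I: ideal "I [^]\<^bsub>ideals_set R\<^esub> (Suc (d + e))" R using ideal_power[OF assms(1)] .
  have c: "a \<in> carrier R" "b \<in> carrier R" "s \<in> carrier R"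
    using r assms(6) ideal.Icarr[OF ideal_power[OF assms(1)]] forms_closed[OF assms(1,2,3)]
      forms_closed[OF assms(1,2,4)] by (blast+)
  have "c \<otimes> (b \<otimes> s) = \<zero> \<oplus> c \<otimes> (b \<otimes> s)" using c assms(2) by simp
  then have "c \<otimes> (b \<otimes> s) \<in> forms R I c (v \<otimes> w) (Suc d + e)"
    using Suc.IH[OF r(3)] I.zero_closed by auto
  moreover have "a \<otimes> s \<in> forms R I c \<zero> (Suc d + e)"
    using ideal_power_mult_forms[OF assms(1,2,4) _ r(2) assms(6)] by simp
  ultimately have "a \<otimes> s \<oplus> c \<otimes> (b \<otimes> s) \<in> forms R I c (\<zero> \<oplus> v \<otimes> w) (Suc d + e)"
    using assms by (intro forms_add) auto
  then show ?case using c assms by (simp add: r l_distr m_assoc)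
qed

lemma forms_coefficients:
  assumes "ideal I R" "c \<in> carrier R" "w \<in> carrier R" "r \<in> forms R I c w d"
  shows "\<exists>a. (\<forall>i\<in>{1..d}. a i \<in> I [^]\<^bsub>ideals_set R\<^esub> i) \<and>
    r = w \<otimes> c [^] d \<oplus> (\<Oplus>i\<in>{1..d}. a i \<otimes> c [^] (d - i))"
  using assms(4)
proof (induction d arbitrary: r)
  case 0
  then show ?case using assms by auto
next
  case (Suc d)
  obtain a b where r: "r = a \<oplus> c \<otimes> b" "a \<in> I [^]\<^bsub>ideals_set R\<^esub> Suc d" "b \<in> forms R I c w d"
    using Suc.prems by auto
  obtain f where f: "\<forall>i\<in>{1..d}. f i \<in> I [^]\<^bsub>ideals_set R\<^esub> i"
    and b: "b = w \<otimes> c [^] d \<oplus> (\<Oplus>i\<in>{1..d}. f i \<otimes> c [^] (d - i))"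
    using Suc.IH[OF r(3)] by blast
  define g where "g = f(Suc d := a)"
  have aR: "a \<in> carrier R" using r(2) ideal.Icarr[OF ideal_power[OF assms(1)]] by blast
  have fR: "f i \<in> carrier R" if "i \<in> {1..d}" for i
    using f that ideal.Icarr[OF ideal_power[OF assms(1)]] by blast
  have sumR: "(\<lambda>i. f i \<otimes> c [^] (d - i)) \<in> {1..d} \<rightarrow> carrier R"
    using fR assms(2) by auto
  have "(\<Oplus>i\<in>{1..Suc d}. g i \<otimes> c [^] (Suc d - i)) =
      a \<oplus> (\<Oplus>i\<in>{1..d}. g i \<otimes> c [^] (Suc d - i))"
    using fR aR assms(2) by (subst atLeastAtMostSuc_conv) (auto simp: g_def Pi_def)
  also have "(\<Oplus>i\<in>{1..d}. g i \<otimes> c [^] (Suc d - i)) = (\<Oplus>i\<in>{1..d}. c \<otimes> (f i \<otimes> c [^] (d - i)))"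
    using fR assms(2)
    by (intro finsum_cong') (auto simp: g_def Suc_diff_le m_assoc m_comm m_lcomm)
  also have "\<dots> = c \<otimes> (\<Oplus>i\<in>{1..d}. f i \<otimes> c [^] (d - i))"
    using finsum_rdistr[OF _ assms(2) sumR] by simp
  finally have sum: "(\<Oplus>i\<in>{1..Suc d}. g i \<otimes> c [^] (Suc d - i)) =
      a \<oplus> c \<otimes> (\<Oplus>i\<in>{1..d}. f i \<otimes> c [^] (d - i))" .
  have "(\<Oplus>i\<in>{1..d}. f i \<otimes> c [^] (d - i)) \<in> carrier R" using sumR by simp
  then have "r = w \<otimes> c [^] Suc d \<oplus> (\<Oplus>i\<in>{1..Suc d}. g i \<otimes> c [^] (Suc d - i))"
    unfolding sum using aR assms(2,3) by (simp add: r b r_distr a_ac m_ac)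
  moreover have "\<forall>i\<in>{1..Suc d}. g i \<in> I [^]\<^bsub>ideals_set R\<^esub> i"
    using f r(2) by (auto simp: g_def)
  ultimately show ?case by blast
qed

text \<open>The determinant trick. The forms with leading coefficient \<open>1\<close> and with leading coefficient
  \<open>0\<close> are the monic elements and the elements without leading term of the elimination. It yields a
  monic form \<open>s\<close> that kills the ideal generated by \<open>gs\<close>; since this ideal contains \<open>c\<close>, the monic form
  \<open>s c\<close> vanishes.\<close>

lemma integral_closureI:
  assumes "ideal I R" "c \<in> carrier R" and gs: "set gs \<subseteq> carrier R"
    and rows: "\<forall>g\<in>set gs. c \<otimes> g \<in> lin_combs (regular_module R) I gs"
    and c: "c \<in> Idl (set gs)"
  shows "c \<in> integral_closure R I"
proof -
  interpret M: module R "regular_module R" by (rule module_regular_module)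
  let ?S = "forms R I c \<one>" and ?A = "forms R I c \<zero>"
  have N: "submodule {\<zero>} R (regular_module R)"
    using submodule_regular_module[OF zeroideal] .
  have cS: "c \<in> ?S 1"
  proof -
    have "c = \<zero> \<oplus> c \<otimes> \<one>" using assms by simp
    moreover have "\<zero> \<in> I [^]\<^bsub>ideals_set R\<^esub> Suc 0"
      using additive_subgroup.zero_closed[OF ideal.axioms(1)[OF ideal_power[OF assms(1)]]] .
    ultimately show ?thesis by auto
  qed
  have "\<exists>e. \<exists>s\<in>?S e. \<forall>g\<in>set gs. s \<odot>\<^bsub>regular_module R\<^esub> g \<in> {\<zero>}"
  proof (rule M.elimination[where S = ?S and A = ?A and d = 1, OF N])
    show "s \<otimes> t \<in> ?S (d + e)" if "s \<in> ?S d" "t \<in> ?S e" for s t d e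
      using forms_mult[OF assms(1,2) _ _ that] by simp
    show "s \<otimes> t \<in> ?A (d + e)" if "s \<in> ?S d" "t \<in> ?A e" for s t d e
      using forms_mult[OF assms(1,2) _ _ that] by simp
    show "s \<otimes> t \<in> ?A (d + e)" if "s \<in> ?A d" "t \<in> ?A e" for s t d e
      using forms_mult[OF assms(1,2) _ _ that] by simp
    show "s \<oplus> t \<in> ?A d" if "s \<in> ?A d" "t \<in> ?A d" for s t d
      using forms_add[OF assms(1,2) _ _ that] by simp
    show "s \<ominus> t \<in> ?S d" if "s \<in> ?S d" "t \<in> ?A d" for s t d
      using forms_add[OF assms(1,2) _ _ that(1) forms_uminus[OF assms(1,2) _ that(2)]]
      by (simp add: a_minus_def)
    have IA: "I \<subseteq> ?A 1"
      using ideal_power_subset_forms[OF assms(1,2), of 1] ideal_power_one[OF assms(1)] by simp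
    show "\<forall>g\<in>set gs. \<exists>s\<in>?S 1. \<exists>n\<in>{\<zero>}. \<exists>w\<in>lin_combs (regular_module R) (?A 1) gs.
        s \<odot>\<^bsub>regular_module R\<^esub> g = n \<oplus>\<^bsub>regular_module R\<^esub> w"
    proof
      fix g assume g: "g \<in> set gs"
      have "c \<otimes> g \<in> lin_combs (regular_module R) (?A 1) gs"
        using rows g M.lin_combs_mono[OF IA, of gs] by blast
      moreover have "c \<odot>\<^bsub>regular_module R\<^esub> g = \<zero> \<oplus>\<^bsub>regular_module R\<^esub> (c \<otimes> g)"
        using g gs assms(2) by auto
      ultimately show "\<exists>s\<in>?S 1. \<exists>n\<in>{\<zero>}. \<exists>w\<in>lin_combs (regular_module R) (?A 1) gs.
        s \<odot>\<^bsub>regular_module R\<^esub> g = n \<oplus>\<^bsub>regular_module R\<^esub> w"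
        using cS by blast
    qed
  qed (use gs forms_closed[OF assms(1,2)] in auto)
  then obtain e s where s: "s \<in> ?S e" and kill: "\<forall>g\<in>set gs. s \<otimes> g = \<zero>" by auto
  have sR: "s \<in> carrier R" using s forms_closed[OF assms(1,2)] by auto
  have "c \<in> lin_combs (regular_module R) (carrier R) gs"
    using c lin_combs_regular_eq_Idl[OF gs] by simp
  then have "s \<odot>\<^bsub>regular_module R\<^esub> c \<in> {\<zero>}"
    using kill gs sR by (intro M.lin_combs_smult_submodule[OF N, of "carrier R" gs]) auto
  then have sc: "s \<otimes> c = \<zero>" by simp
  have "s \<otimes> c \<in> ?S (e + 1)"
    using forms_mult[OF assms(1,2) _ _ s cS] by simp
  then obtain a where a: "\<forall>i\<in>{1..e + 1}. a i \<in> I [^]\<^bsub>ideals_set R\<^esub> i"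
    and eq: "s \<otimes> c = \<one> \<otimes> c [^] (e + 1) \<oplus> (\<Oplus>i\<in>{1..e + 1}. a i \<otimes> c [^] (e + 1 - i))"
    using forms_coefficients[OF assms(1,2) one_closed] by blast
  then have "c [^] (e + 1) \<oplus> (\<Oplus>i\<in>{1..e + 1}. a i \<otimes> c [^] (e + 1 - i)) = \<zero>"
    using sc assms(2) by simp
  then show ?thesis
    unfolding integral_closure_def using assms(2) a
    by (intro CollectI conjI exI[of _ "e + 1"] exI[of _ a]) auto
qed

end

section \<open>Prime ideals and Krull's height theorem\<close>

locale noetherian_cring = cring R + noetherian_ring R for R (structure)

sublocale noetherian_local_ring \<subseteq> noetherian_cring ..

definition adjoin :: "('a, 'b) ring_scheme \<Rightarrow> 'a set \<Rightarrow> 'a \<Rightarrow> 'a set" where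
  "adjoin R J z = {j \<oplus>\<^bsub>R\<^esub> r \<otimes>\<^bsub>R\<^esub> z | j r. j \<in> J \<and> r \<in> carrier R}"

text \<open>The contraction to \<open>R\<close> of the extension of \<open>J\<close> to the localization at \<open>P\<close>. The contracted
  ideals correspond to the ideals of the localization.\<close>

definition contraction :: "('a, 'b) ring_scheme \<Rightarrow> 'a set \<Rightarrow> 'a set \<Rightarrow> 'a set" where
  "contraction R P J = {r \<in> carrier R. \<exists>s\<in>carrier R - P. s \<otimes>\<^bsub>R\<^esub> r \<in> J}"

definition contracted :: "('a, 'b) ring_scheme \<Rightarrow> 'a set \<Rightarrow> 'a set \<Rightarrow> bool" where
  "contracted R P J \<longleftrightarrow> ideal J R \<and>
     (\<forall>s\<in>carrier R - P. \<forall>r\<in>carrier R. s \<otimes>\<^bsub>R\<^esub> r \<in> J \<longrightarrow> r \<in> J)"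

lemma contractionI:
  "s \<in> carrier R - P \<Longrightarrow> r \<in> carrier R \<Longrightarrow> s \<otimes>\<^bsub>R\<^esub> r \<in> J \<Longrightarrow> r \<in> contraction R P J"
  unfolding contraction_def by blast

lemma contractedD:
  "contracted R P J \<Longrightarrow> s \<in> carrier R \<Longrightarrow> s \<notin> P \<Longrightarrow> r \<in> carrier R \<Longrightarrow> s \<otimes>\<^bsub>R\<^esub> r \<in> J \<Longrightarrow> r \<in> J"
  unfolding contracted_def by blast

context cring
begin

lemma ideal_adjoin:
  assumes "ideal J R" "z \<in> carrier R"
  shows "ideal (adjoin R J z) R"
proof -
  interpret J: ideal J R by fact
  have JR: "J \<subseteq> carrier R" using J.Icarr by blast
  have mult: "x \<otimes> a \<in> adjoin R J z" if "a \<in> adjoin R J z" "x \<in> carrier R" for a x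
  proof -
    obtain j r where a: "a = j \<oplus> r \<otimes> z" "j \<in> J" "r \<in> carrier R"
      using \<open>a \<in> adjoin R J z\<close> by (auto simp: adjoin_def)
    have "x \<otimes> a = x \<otimes> j \<oplus> (x \<otimes> r) \<otimes> z"
      using a that assms JR by (auto simp: r_distr m_assoc)
    then show ?thesis using J.I_l_closed[OF a(2) that(2)] a that by (auto simp: adjoin_def)
  qed
  have sub: "adjoin R J z \<subseteq> carrier R" using JR assms by (auto simp: adjoin_def)
  show ?thesis
  proof (rule idealI)
    show "subgroup (adjoin R J z) (add_monoid R)"
    proof (rule add.subgroupI)
      show "adjoin R J z \<noteq> {}" using J.zero_closed zero_closed unfolding adjoin_def by blast
      show "\<ominus> a \<in> adjoin R J z" if "a \<in> adjoin R J z" for a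
        using mult[OF that, of "\<ominus> \<one>"] that sub by (auto simp: l_minus)
      fix a b assume "a \<in> adjoin R J z" "b \<in> adjoin R J z"
      then obtain j r k s where ab: "a = j \<oplus> r \<otimes> z" "j \<in> J" "r \<in> carrier R"
          "b = k \<oplus> s \<otimes> z" "k \<in> J" "s \<in> carrier R"
        by (auto simp: adjoin_def)
      then have "a \<oplus> b = (j \<oplus> k) \<oplus> (r \<oplus> s) \<otimes> z"
        using JR assms by (simp add: subset_iff l_distr a_ac)
      then show "a \<oplus> b \<in> adjoin R J z" using ab J.a_closed by (auto simp: adjoin_def)
    qed (rule sub)
    show "a \<otimes> x \<in> adjoin R J z" if "a \<in> adjoin R J z" "x \<in> carrier R" for a x
      using mult[OF that] that sub by (auto simp: m_comm)
  qed (use mult ring_axioms in auto)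
qed

lemma adjoin_superset:
  assumes "ideal J R" "z \<in> carrier R"
  shows "J \<subseteq> adjoin R J z" "z \<in> adjoin R J z"
proof -
  interpret J: ideal J R by fact
  have "j = j \<oplus> \<zero> \<otimes> z" if "j \<in> J" for j using that J.Icarr assms by auto
  then show "J \<subseteq> adjoin R J z" unfolding adjoin_def by blast
  have "z = \<zero> \<oplus> \<one> \<otimes> z" using assms by auto
  then show "z \<in> adjoin R J z" unfolding adjoin_def using J.zero_closed by blast
qed

lemma adjoin_mono: "J \<subseteq> K \<Longrightarrow> adjoin R J z \<subseteq> adjoin R K z"
  unfolding adjoin_def by blast

lemma adjoin_least:
  assumes "ideal K R" "J \<subseteq> K" "z \<in> K"
  shows "adjoin R J z \<subseteq> K"
proof -
  interpret K: ideal K R by fact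
  show ?thesis using assms K.I_l_closed K.a_closed by (auto simp: adjoin_def)
qed

lemma prime_complement_mult:
  assumes "primeideal P R" "s \<in> carrier R - P" "t \<in> carrier R - P"
  shows "s \<otimes> t \<in> carrier R - P"
proof -
  interpret P: primeideal P R by fact
  show ?thesis using assms P.I_prime by auto
qed

lemma prime_complement_one:
  assumes "primeideal P R"
  shows "\<one> \<in> carrier R - P"
proof -
  interpret P: primeideal P R by fact
  show ?thesis using P.I_notcarr P.one_imp_carrier by auto
qed

lemma prime_complement_pow:
  assumes "primeideal P R" "s \<in> carrier R - P"
  shows "s [^] (n::nat) \<in> carrier R - P"
proof (induction n)
  case (Suc n)
  then show ?case using prime_complement_mult[OF assms(1) Suc assms(2)] by simp
qed (use prime_complement_one[OF assms(1)] in simp)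

lemma contracted_contraction:
  assumes "primeideal P R" "ideal J R"
  shows "contracted R P (contraction R P J)"
proof -
  interpret J: ideal J R by fact
  note mult = prime_complement_mult[OF assms(1)]
  have sub: "contraction R P J \<subseteq> carrier R" by (auto simp: contraction_def)
  have l: "x \<otimes> a \<in> contraction R P J" if "a \<in> contraction R P J" "x \<in> carrier R" for a x
  proof -
    obtain s where s: "s \<in> carrier R - P" "s \<otimes> a \<in> J" and a: "a \<in> carrier R"
      using \<open>a \<in> contraction R P J\<close> unfolding contraction_def by blast
    have "s \<otimes> (x \<otimes> a) = x \<otimes> (s \<otimes> a)" using s a that by (auto simp: m_lcomm)
    then show ?thesis
      using J.I_l_closed[OF s(2) that(2)] s(1) a that(2) by (auto intro: contractionI[of s])
  qed
  have "ideal (contraction R P J) R"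
  proof (rule idealI)
    show "subgroup (contraction R P J) (add_monoid R)"
    proof (rule add.subgroupI)
      show "contraction R P J \<noteq> {}"
        using J.zero_closed prime_complement_one[OF assms(1)] by (force simp: contraction_def)
      show "\<ominus> a \<in> contraction R P J" if "a \<in> contraction R P J" for a
        using l[OF that, of "\<ominus> \<one>"] that sub by (auto simp: l_minus)
      fix a b assume "a \<in> contraction R P J" "b \<in> contraction R P J"
      then obtain s t where s: "s \<in> carrier R - P" "s \<otimes> a \<in> J" "a \<in> carrier R"
        and t: "t \<in> carrier R - P" "t \<otimes> b \<in> J" "b \<in> carrier R"
        by (auto simp: contraction_def)
      have "(s \<otimes> t) \<otimes> (a \<oplus> b) = t \<otimes> (s \<otimes> a) \<oplus> s \<otimes> (t \<otimes> b)"
        using s t by (auto simp: r_distr m_ac)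
      then have "(s \<otimes> t) \<otimes> (a \<oplus> b) \<in> J"
        using J.I_l_closed s t J.a_closed by auto
      then show "a \<oplus> b \<in> contraction R P J"
        using mult[OF s(1) t(1)] s(3) t(3) by (auto intro: contractionI[of "s \<otimes> t"])
    qed (rule sub)
    show "a \<otimes> x \<in> contraction R P J" if "a \<in> contraction R P J" "x \<in> carrier R" for a x
      using l[OF that] that sub by (auto simp: m_comm)
  qed (use l ring_axioms in auto)
  moreover have "r \<in> contraction R P J"
    if sr: "s \<in> carrier R - P" "r \<in> carrier R" "s \<otimes> r \<in> contraction R P J" for s r
  proof -
    obtain t where t: "t \<in> carrier R - P" "t \<otimes> (s \<otimes> r) \<in> J"
      using sr by (auto simp: contraction_def)
    then have "(t \<otimes> s) \<otimes> r \<in> J" using sr by (auto simp: m_assoc)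
    then show ?thesis using mult[OF t(1) sr(1)] sr unfolding contraction_def by blast
  qed
  ultimately show ?thesis by (auto simp: contracted_def)
qed

lemma contraction_superset:
  assumes "primeideal P R" "ideal J R"
  shows "J \<subseteq> contraction R P J"
  using prime_complement_one[OF assms(1)] ideal.Icarr[OF assms(2)]
  by (force simp: contraction_def)

lemma contraction_least: "contracted R P K \<Longrightarrow> J \<subseteq> K \<Longrightarrow> contraction R P J \<subseteq> K"
  by (auto simp: contraction_def contracted_def)

lemma contraction_mono: "J \<subseteq> K \<Longrightarrow> contraction R P J \<subseteq> contraction R P K"
  by (auto simp: contraction_def)

lemma ideal_colon:
  assumes "ideal J R" "z \<in> carrier R"
  shows "ideal {r \<in> carrier R. r \<otimes> z \<in> J} R"
proof -
  interpret J: ideal J R by fact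
  have l: "x \<otimes> r \<otimes> z \<in> J" if "r \<in> carrier R" "r \<otimes> z \<in> J" "x \<in> carrier R" for x r
    using J.I_l_closed[OF that(2,3)] that assms by (simp add: m_assoc)
  show ?thesis
  proof (rule idealI)
    show "subgroup {r \<in> carrier R. r \<otimes> z \<in> J} (add_monoid R)"
      using assms J.zero_closed J.a_closed J.a_inv_closed
      by (intro add.subgroupI) (auto simp: l_distr l_minus intro!: exI[of _ \<zero>])
    show "r \<otimes> x \<in> {r \<in> carrier R. r \<otimes> z \<in> J}" if "r \<in> {r \<in> carrier R. r \<otimes> z \<in> J}" "x \<in> carrier R" for r x
      using l[of r x] that by (simp add: m_comm[of r x])
  qed (use l ring_axioms in auto)
qed

lemma prime_radical:
  assumes "primeideal P R" "x \<in> carrier R" "x [^] (n::nat) \<in> P"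
  shows "x \<in> P"
  using prime_complement_pow[OF assms(1), of x n] assms by blast

end

context noetherian_cring
begin

lemma exists_maximal_ideal_with:
  assumes "\<phi> J" "\<And>J. \<phi> J \<Longrightarrow> ideal J R"
  shows "\<exists>K. \<phi> K \<and> (\<forall>L. \<phi> L \<longrightarrow> K \<subseteq> L \<longrightarrow> L = K)"
proof -
  have "\<exists>K\<in>Collect \<phi>. \<forall>L\<in>Collect \<phi>. K \<subseteq> L \<longrightarrow> L = K"
  proof (rule subset_Zorn_nonempty)
    show "Collect \<phi> \<noteq> {}" using assms(1) by blast
    fix C assume C: "C \<noteq> {}" "subset.chain (Collect \<phi>) C"
    then have "subset.chain {I. ideal I R} C"
      using assms(2) by (auto simp: subset.chain_def)
    then have "\<Union>C \<in> C" using ideal_chain_is_trivial[OF C(1)] by blast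
    then show "\<Union>C \<in> Collect \<phi>" using C(2) by (auto simp: subset.chain_def)
  qed
  then show ?thesis by auto
qed

lemma exists_generating_list:
  assumes "ideal I R"
  obtains gs where "set gs \<subseteq> carrier R" "I = Idl (set gs)"
proof -
  obtain A where "A \<subseteq> carrier R" "finite A" "I = Idl A"
    using finetely_gen[OF assms] by blast
  then show ?thesis using that finite_list by blast
qed

text \<open>An ideal that is maximal among those that contain \<open>J\<close> and avoid the multiplicative set \<open>S\<close> is
  prime: if it contained neither \<open>a\<close> nor \<open>b\<close>, adjoining either would reach \<open>S\<close>, and the product of the two
  elements reached lies in \<open>S\<close> and, if \<open>a b\<close> is in the ideal, in the ideal.\<close>

lemma exists_prime_avoiding:
  assumes "ideal J R" "S \<subseteq> carrier R" "\<one> \<in> S" "\<And>s t. s \<in> S \<Longrightarrow> t \<in> S \<Longrightarrow> s \<otimes> t \<in> S"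
    and "J \<inter> S = {}"
  obtains P where "primeideal P R" "J \<subseteq> P" "P \<inter> S = {}"
proof -
  define \<phi> where "\<phi> K \<longleftrightarrow> ideal K R \<and> J \<subseteq> K \<and> K \<inter> S = {}" for K
  have "\<phi> J" using assms(1,5) by (simp add: \<phi>_def)
  moreover have "\<And>K. \<phi> K \<Longrightarrow> ideal K R" by (simp add: \<phi>_def)
  ultimately obtain P where "\<phi> P" and max0: "\<And>K. \<phi> K \<Longrightarrow> P \<subseteq> K \<Longrightarrow> K = P"
    using exists_maximal_ideal_with by blast
  then have P: "ideal P R" "J \<subseteq> P" "P \<inter> S = {}" by (simp_all add: \<phi>_def)
  have max: "K = P" if "ideal K R" "K \<inter> S = {}" "P \<subseteq> K" for K
    using max0[of K] that P(2) by (simp add: \<phi>_def)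
  interpret P: ideal P R by fact
  have meets: "\<exists>p\<in>P. \<exists>r\<in>carrier R. p \<oplus> r \<otimes> a \<in> S" if "a \<in> carrier R" "a \<notin> P" for a
  proof -
    have "adjoin R P a \<inter> S \<noteq> {}"
      using max[OF ideal_adjoin[OF P(1) that(1)] _ adjoin_superset(1)[OF P(1) that(1)]]
        adjoin_superset(2)[OF P(1) that(1)] that(2) by metis
    then show ?thesis unfolding adjoin_def by blast
  qed
  have "primeideal P R"
  proof (rule primeidealI[OF P(1) is_cring])
    show "carrier R \<noteq> P" using assms(3) P(3) by blast
    fix a b assume ab: "a \<in> carrier R" "b \<in> carrier R" "a \<otimes> b \<in> P"
    show "a \<in> P \<or> b \<in> P"
    proof (rule ccontr)
      assume "\<not> (a \<in> P \<or> b \<in> P)"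
      then have "a \<notin> P" "b \<notin> P" by auto
      obtain p r where p: "p \<in> P" "r \<in> carrier R" "p \<oplus> r \<otimes> a \<in> S"
        using meets[OF ab(1) \<open>a \<notin> P\<close>] by blast
      obtain q t where q: "q \<in> P" "t \<in> carrier R" "q \<oplus> t \<otimes> b \<in> S"
        using meets[OF ab(2) \<open>b \<notin> P\<close>] by blast
      have c: "p \<in> carrier R" "q \<in> carrier R" using p q P.Icarr by auto
      have "(p \<oplus> r \<otimes> a) \<otimes> (q \<oplus> t \<otimes> b) = (q \<oplus> t \<otimes> b) \<otimes> p \<oplus> ((r \<otimes> a) \<otimes> q \<oplus> (r \<otimes> t) \<otimes> (a \<otimes> b))"
        using c p(2) q(2) ab by (simp add: l_distr r_distr m_ac a_ac)
      also have "\<dots> \<in> P"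
        using P.I_l_closed[OF p(1), of "q \<oplus> t \<otimes> b"] P.I_l_closed[OF q(1), of "r \<otimes> a"]
          P.I_l_closed[OF ab(3), of "r \<otimes> t"] c p(2) q(2) ab(1,2)
        by (intro P.a_closed) simp_all
      finally show False using assms(4)[OF p(3) q(3)] P(3) by blast
    qed
  qed
  then show ?thesis by (rule that[OF _ P(2,3)])
qed

text \<open>Existence of an associated prime of \<open>R/K\<close>: a maximal annihilator of a nonzero element is prime.\<close>

lemma exists_prime_colon:
  assumes "ideal K R" "K \<noteq> carrier R"
  obtains z where "z \<in> carrier R" "z \<notin> K" "primeideal {r \<in> carrier R. r \<otimes> z \<in> K} R"
proof -
  interpret K: ideal K R by fact
  let ?col = "\<lambda>z. {r \<in> carrier R. r \<otimes> z \<in> K}"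
  define \<phi> where "\<phi> J \<longleftrightarrow> (\<exists>z\<in>carrier R - K. J = ?col z)" for J
  obtain w where "w \<in> carrier R - K" using assms(2) K.Icarr by auto
  then have "\<phi> (?col w)" unfolding \<phi>_def by blast
  moreover have "\<And>J. \<phi> J \<Longrightarrow> ideal J R" using ideal_colon[OF assms(1)] by (auto simp: \<phi>_def)
  ultimately obtain Q where "\<phi> Q" and maxQ: "\<And>J. \<phi> J \<Longrightarrow> Q \<subseteq> J \<Longrightarrow> J = Q"
    using exists_maximal_ideal_with by blast
  then obtain z where z: "z \<in> carrier R" "z \<notin> K" and Q: "Q = ?col z"
    unfolding \<phi>_def by blast
  have max: "?col w = ?col z" if "w \<in> carrier R - K" "?col z \<subseteq> ?col w" for w
    using maxQ[of "?col w"] that unfolding Q \<phi>_def by blast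
  have "primeideal (?col z) R"
  proof (rule primeidealI[OF ideal_colon[OF assms(1) z(1)] is_cring])
    have "\<one> \<notin> ?col z" using z by simp
    then show "carrier R \<noteq> ?col z" using one_closed by blast
    fix a b assume ab: "a \<in> carrier R" "b \<in> carrier R" "a \<otimes> b \<in> ?col z"
    show "a \<in> ?col z \<or> b \<in> ?col z"
    proof (rule disjCI)
      assume "b \<notin> ?col z"
      then have bz: "b \<otimes> z \<in> carrier R - K" using ab z by auto
      have "?col z \<subseteq> ?col (b \<otimes> z)"
      proof
        fix r assume r: "r \<in> ?col z"
        then have "r \<otimes> (b \<otimes> z) = b \<otimes> (r \<otimes> z)" using ab z by (simp add: m_lcomm)
        then show "r \<in> ?col (b \<otimes> z)" using K.I_l_closed[of "r \<otimes> z" b] r ab(2) by simp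
      qed
      moreover have "a \<in> ?col (b \<otimes> z)" using ab z by (auto simp: m_assoc)
      ultimately show "a \<in> ?col z" using max[OF bz] by blast
    qed
  qed
  then show ?thesis using that z by blast
qed

text \<open>If \<open>P\<close> is minimal over \<open>K\<close>, the localization of \<open>R/K\<close> at \<open>P\<close> is Artinian. Consider a maximal ideal \<open>K\<close> for
  which this fails. It is contracted, and its only possible associated prime inside \<open>P\<close> is \<open>P\<close>, so
  there is \<open>z \<notin> K\<close> with \<open>z P \<subseteq> K\<close>. By maximality a descending chain stabilizes after adding \<open>z\<close>. If all
  its members contain \<open>z\<close> this is the chain itself; otherwise, as \<open>K + (z)\<close> is locally of length one
  over \<open>K\<close>, a member without \<open>z\<close> meets it in \<open>K\<close> only, and the chain is determined by its sums
  with \<open>z\<close>.\<close>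

lemma contracted_chain_stabilizes:
  assumes P: "primeideal P R" and "ideal K R"
    and "\<And>Q. primeideal Q R \<Longrightarrow> K \<subseteq> Q \<Longrightarrow> Q \<subseteq> P \<Longrightarrow> Q = P"
    and "\<And>n. contracted R P (F n)" "\<And>n. K \<subseteq> F n" "\<And>n::nat. F (Suc n) \<subseteq> F n"
  shows "\<exists>n. \<forall>m\<ge>n. F m = F n"
proof (rule ccontr)
  assume unstable: "\<nexists>n. \<forall>m\<ge>n. F m = F n"
  \<comment> \<open>\<open>bad\<close> ideals: \<open>P\<close> is minimal over them, and they have an unstable descending chain above them\<close>
  define iso where "iso J \<longleftrightarrow> (\<forall>Q. primeideal Q R \<longrightarrow> J \<subseteq> Q \<longrightarrow> Q \<subseteq> P \<longrightarrow> Q = P)" for J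
  define desc where "desc J F \<longleftrightarrow>
    (\<forall>n. contracted R P (F n)) \<and> (\<forall>n. J \<subseteq> F n) \<and> (\<forall>n::nat. F (Suc n) \<subseteq> F n)" for J F
  define stable where "stable F \<longleftrightarrow> (\<exists>n::nat. \<forall>m\<ge>n. F m = F n)" for F :: "nat \<Rightarrow> 'a set"
  define bad where "bad J \<longleftrightarrow> ideal J R \<and> iso J \<and> (\<exists>F. desc J F \<and> \<not> stable F)" for J
  have "iso K" "desc K F" "\<not> stable F"
    using assms unstable by (simp_all add: iso_def desc_def stable_def)
  then have "bad K" using assms(2) by (auto simp: bad_def)
  moreover have "\<And>J. bad J \<Longrightarrow> ideal J R" by (simp add: bad_def)
  ultimately obtain K where "bad K" and max: "\<And>J. bad J \<Longrightarrow> K \<subseteq> J \<Longrightarrow> J = K"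
    using exists_maximal_ideal_with by blast
  then obtain F where K: "ideal K R" "iso K" and desc: "desc K F" and F_unstable: "\<not> stable F"
    by (auto simp: bad_def)
  have F: "contracted R P (F n)" "K \<subseteq> F n" "F (Suc n) \<subseteq> F n" for n
    using desc by (auto simp: desc_def)
  have Fid: "ideal (F n) R" for n using F(1)[of n] by (simp add: contracted_def)
  have iso_mono: "iso J" if "K \<subseteq> J" for J
    using that K(2) by (auto simp: iso_def)
  have max': "J = K" if "ideal J R" "K \<subseteq> J" "desc J G" "\<not> stable G" for J G
    using max[of J] that iso_mono by (auto simp: bad_def)
  have F_anti: "F m \<subseteq> F n" if "n \<le> m" for m n
    using lift_Suc_antimono_le[of F, OF F(3) that] by simp
  interpret K: ideal K R by fact
  have "contraction R P K = K"
  proof (rule max'[OF _ contraction_superset[OF P K(1)] _ F_unstable])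
    show "ideal (contraction R P K) R"
      using contracted_contraction[OF P K(1)] by (simp add: contracted_def)
    show "desc (contraction R P K) F"
      using F contraction_least[OF F(1) F(2)] by (simp add: desc_def)
  qed
  then have K_contr: "contracted R P K" using contracted_contraction[OF P K(1)] by simp
  have "K \<noteq> carrier R"
  proof
    assume "K = carrier R"
    then have "F n = carrier R" for n
      using F(2)[of n] ideal.Icarr[OF Fid[of n]] by blast
    then show False using F_unstable by (simp add: stable_def)
  qed
  then obtain z where z: "z \<in> carrier R" "z \<notin> K" and col: "primeideal {r \<in> carrier R. r \<otimes> z \<in> K} R"
    using exists_prime_colon[OF K(1)] by metis
  have "{r \<in> carrier R. r \<otimes> z \<in> K} = P"
  proof -
    have "{r \<in> carrier R. r \<otimes> z \<in> K} \<subseteq> P" using K_contr z by (auto simp: contracted_def)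
    moreover have "K \<subseteq> {r \<in> carrier R. r \<otimes> z \<in> K}" using K.I_r_closed K.Icarr z by auto
    ultimately show ?thesis using K(2) col by (simp add: iso_def)
  qed
  then have Pz: "r \<otimes> z \<in> K" if "r \<in> P" for r using that by blast
  note K_adjoin = adjoin_superset[OF K(1) z(1)]
  have K'_stable: "stable G" if "desc (adjoin R K z) G" for G
    using max'[OF ideal_adjoin[OF K(1) z(1)] K_adjoin(1) that] K_adjoin(2) z(2) by metis
  let ?G = "\<lambda>n. contraction R P (adjoin R (F n) z)"
  have "desc (adjoin R K z) ?G"
    unfolding desc_def
  proof (intro conjI allI)
    fix n
    show "contracted R P (?G n)" by (rule contracted_contraction[OF P ideal_adjoin[OF Fid z(1)]])
    show "adjoin R K z \<subseteq> ?G n"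
      using contraction_superset[OF P ideal_adjoin[OF Fid z(1)]] adjoin_mono[OF F(2)] by (rule subset_trans[rotated])
    show "?G (Suc n) \<subseteq> ?G n" using F by (intro contraction_mono adjoin_mono) auto
  qed
  then obtain n0 where n0: "\<forall>m\<ge>n0. ?G m = ?G n0" using K'_stable unfolding stable_def by blast
  have "\<not> (\<forall>n. z \<in> F n)"
  proof
    assume "\<forall>n. z \<in> F n"
    then have "desc (adjoin R K z) F" using F adjoin_least[OF Fid F(2)] by (simp add: desc_def)
    then show False using K'_stable F_unstable by blast
  qed
  then obtain n1 where n1: "z \<notin> F n1" by blast
  define N where "N = max n0 n1"
  have zN: "z \<notin> F N" using n1 F_anti[of n1 N] by (auto simp: N_def)
  have "F N \<subseteq> F m" if m: "m \<ge> N" for m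
  proof
    fix v assume v: "v \<in> F N"
    interpret FN: ideal "F N" R by (rule Fid)
    interpret Fm: ideal "F m" R by (rule Fid)
    have "v \<in> ?G N"
      using v adjoin_superset[OF Fid z(1)] contraction_superset[OF P ideal_adjoin[OF Fid z(1)]]
      by blast
    moreover have "?G N = ?G n0" "?G m = ?G n0"
      using n0[rule_format, of N] n0[rule_format, of m] m by (simp_all add: N_def)
    ultimately have "v \<in> ?G m" by simp
    then obtain s f r where s: "s \<in> carrier R - P" "f \<in> F m" "r \<in> carrier R" "s \<otimes> v = f \<oplus> r \<otimes> z"
      unfolding contraction_def adjoin_def by blast
    have vR: "v \<in> carrier R" and fR: "f \<in> carrier R" using v s FN.Icarr Fm.Icarr by auto
    have fN: "f \<in> F N" using s F_anti[OF m] by auto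
    have "r \<otimes> z = s \<otimes> v \<oplus> \<ominus> f"
      using s z vR fR by (simp add: a_comm[of f] a_assoc r_neg)
    also have "\<dots> \<in> F N" using s v fN by (intro FN.a_closed FN.I_l_closed FN.a_inv_closed) auto
    finally have "r \<otimes> z \<in> F N" .
    then have "r \<in> P" using contractedD[OF F(1)[of N] s(3) _ z(1)] zN by blast
    then have "r \<otimes> z \<in> F m" using Pz F(2) by blast
    then have "s \<otimes> v \<in> F m" using s(4) Fm.a_closed[OF s(2)] by simp
    then show "v \<in> F m" using contractedD[OF F(1)[of m] _ _ vR] s(1) by blast
  qed
  then have "\<forall>m\<ge>N. F m = F N" using F_anti by (simp add: subset_antisym)
  then show False using F_unstable unfolding stable_def by blast
qed

text \<open>Krull's principal ideal theorem, relative to a prime \<open>Q0\<close>: if \<open>P\<close> has height at least two over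
  \<open>Q0\<close>, it is not minimal over \<open>Q0 + (x)\<close>. Suppose it is. Choose \<open>y \<in> Q1\<close> outside \<open>Q0\<close>, and let \<open>I n\<close> be the
  contraction of \<open>Q0 + (y\<^sup>n)\<close> from the localization at \<open>Q1\<close>. Modulo \<open>x\<close> the chain \<open>I n\<close> stabilizes
  locally at \<open>P\<close>, so \<open>I n = I (n + 1) + x (I n)\<close> there, because \<open>x \<notin> Q1\<close>. By Nakayama's lemma
  \<open>y\<^sup>n \<in> I (n + 1)\<close>, and this says that \<open>y\<^sup>n\<close> is a multiple of \<open>y\<^sup>n\<^sup>+\<^sup>1\<close> in the localization of
  the domain \<open>R/Q0\<close> at \<open>Q1\<close>, where \<open>y\<close> is neither zero nor a unit.\<close>

lemma exists_prime_between_containing: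
  assumes Q0: "primeideal Q0 R" and Q1: "primeideal Q1 R" and P: "primeideal P R"
    and "Q0 \<subset> Q1" "Q1 \<subset> P" "x \<in> P"
  obtains Q where "primeideal Q R" "Q0 \<subset> Q" "Q \<subset> P" "x \<in> Q"
proof (rule ccontr)
  assume "\<not> thesis"
  then have none: "\<not> (primeideal Q R \<and> Q0 \<subset> Q \<and> Q \<subset> P \<and> x \<in> Q)" for Q using that by blast
  interpret Q0: primeideal Q0 R by fact
  interpret Q1: primeideal Q1 R by fact
  interpret P: primeideal P R by fact
  have xQ1: "x \<notin> Q1" using none Q1 assms by blast
  have xR: "x \<in> carrier R" using assms P.Icarr by auto
  obtain y where y: "y \<in> Q1" "y \<notin> Q0" using assms by blast
  have yR: "y \<in> carrier R" using y Q1.Icarr by auto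
  define I where "I n = contraction R Q1 (adjoin R Q0 (y [^] (n::nat)))" for n
  have ad: "ideal (adjoin R Q0 (y [^] (n::nat))) R" for n
    using ideal_adjoin[OF Q0.is_ideal] yR by simp
  have I_contr: "contracted R Q1 (I n)" for n
    unfolding I_def by (rule contracted_contraction[OF Q1 ad])
  then have I_ideal: "ideal (I n) R" for n by (auto simp: contracted_def)
  have I_anti: "I (Suc n) \<subseteq> I n" for n
  proof -
    have "adjoin R Q0 (y [^] Suc n) \<subseteq> adjoin R Q0 (y [^] n)"
      using adjoin_superset[OF Q0.is_ideal, of "y [^] n"] ideal.I_r_closed[OF ad _ yR] yR
      by (intro adjoin_least[OF ad]) auto
    then show ?thesis unfolding I_def by (rule contraction_mono)
  qed
  have Q0I: "Q0 \<subseteq> I n" and yI: "y [^] n \<in> I n" for n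
    using contraction_superset[OF Q1 ad[of n]] adjoin_superset[OF Q0.is_ideal, of "y [^] n"] yR
    unfolding I_def by auto
  have adI: "ideal (adjoin R (I n) x) R" for n by (rule ideal_adjoin[OF I_ideal xR])
  have "\<exists>n. \<forall>m\<ge>n. contraction R P (adjoin R (I m) x) = contraction R P (adjoin R (I n) x)"
  proof (rule contracted_chain_stabilizes[OF P ideal_adjoin[OF Q0.is_ideal xR]])
    show "Q = P" if "primeideal Q R" "adjoin R Q0 x \<subseteq> Q" "Q \<subseteq> P" for Q
    proof (rule ccontr)
      assume "Q \<noteq> P"
      moreover have "x \<in> Q" "Q0 \<subseteq> Q" using that adjoin_superset[OF Q0.is_ideal xR] by auto
      moreover have "x \<notin> Q0" using xQ1 assms by blast
      ultimately show False using none[of Q] that by blast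
    qed
    show "contracted R P (contraction R P (adjoin R (I n) x))" for n
      by (rule contracted_contraction[OF P adI])
    show "adjoin R Q0 x \<subseteq> contraction R P (adjoin R (I n) x)" for n
      using contraction_superset[OF P adI] adjoin_mono[OF Q0I] by blast
    show "contraction R P (adjoin R (I (Suc n)) x) \<subseteq> contraction R P (adjoin R (I n) x)" for n
      by (intro contraction_mono adjoin_mono I_anti)
  qed
  then obtain n where stable:
      "contraction R P (adjoin R (I (Suc n)) x) = contraction R P (adjoin R (I n) x)"
    by (meson le_SucI order_refl)
  interpret In: ideal "I n" R by (rule I_ideal)
  interpret In': ideal "I (Suc n)" R by (rule I_ideal)
  interpret M: module R "regular_module R" by (rule module_regular_module)
  obtain gs where gs: "set gs \<subseteq> carrier R" "I n = Idl (set gs)"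
    using exists_generating_list[OF I_ideal] by blast
  have "\<exists>s\<in>carrier R - P. \<forall>g\<in>set gs. s \<odot>\<^bsub>regular_module R\<^esub> g \<in> I (Suc n)"
  proof (rule M.nakayama_at_prime[OF submodule_regular_module[OF I_ideal] P])
    show "\<forall>g\<in>set gs. \<exists>s\<in>carrier R - P. \<exists>m\<in>I (Suc n). \<exists>w\<in>lin_combs (regular_module R) P gs.
        s \<odot>\<^bsub>regular_module R\<^esub> g = m \<oplus>\<^bsub>regular_module R\<^esub> w"
    proof
      fix g assume g: "g \<in> set gs"
      have gI: "g \<in> I n" using g genideal_self[OF gs(1)] gs(2) by auto
      then have "g \<in> contraction R P (adjoin R (I (Suc n)) x)"
        unfolding stable
        using adjoin_superset[OF I_ideal xR] contraction_superset[OF P adI] by blast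
      then obtain s m a where s: "s \<in> carrier R - P" "m \<in> I (Suc n)" "a \<in> carrier R"
          "s \<otimes> g = m \<oplus> a \<otimes> x"
        unfolding contraction_def adjoin_def by blast
      have c: "g \<in> carrier R" "m \<in> carrier R" using gI s In.Icarr In'.Icarr by auto
      have "a \<otimes> x = s \<otimes> g \<oplus> \<ominus> m"
        using s c xR by (simp add: a_comm[of m] a_assoc r_neg)
      also have "\<dots> \<in> I n"
        using s gI I_anti by (intro In.a_closed In.I_l_closed In.a_inv_closed) auto
      finally have "x \<otimes> a \<in> I n" using s xR by (simp add: m_comm)
      then have "a \<in> I n" using contractedD[OF I_contr xR xQ1 s(3)] by blast
      then have "a \<in> lin_combs (regular_module R) (carrier R) gs"
        using gs lin_combs_regular_eq_Idl by simp
      then have "x \<odot>\<^bsub>regular_module R\<^esub> a \<in> lin_combs (regular_module R) P gs"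
        using P.I_r_closed[OF assms(6)] xR gs
        by (intro M.lin_combs_smult[of "carrier R" gs x P]) auto
      moreover have "x \<odot>\<^bsub>regular_module R\<^esub> a = a \<otimes> x" using s xR by (simp add: m_comm)
      ultimately show "\<exists>s\<in>carrier R - P. \<exists>m\<in>I (Suc n). \<exists>w\<in>lin_combs (regular_module R) P gs.
        s \<odot>\<^bsub>regular_module R\<^esub> g = m \<oplus>\<^bsub>regular_module R\<^esub> w"
        using s by auto
    qed
  qed (use gs in simp)
  then obtain s where s: "s \<in> carrier R - P" "\<forall>g\<in>set gs. s \<otimes> g \<in> I (Suc n)" by auto
  then have "set gs \<subseteq> I (Suc n)"
    using contractedD[OF I_contr[of "Suc n"], of s] gs(1) assms(5) by blast
  then have "I n \<subseteq> I (Suc n)" using gs(2) genideal_minimal[OF I_ideal] by simp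
  then have "y [^] n \<in> I (Suc n)" using yI by blast
  then obtain t q r where t: "t \<in> carrier R - Q1" "q \<in> Q0" "r \<in> carrier R"
      "t \<otimes> y [^] n = q \<oplus> r \<otimes> y [^] Suc n"
    unfolding I_def contraction_def adjoin_def by blast
  have qR: "q \<in> carrier R" using t Q0.Icarr by auto
  have ry: "r \<otimes> y \<in> Q1" using t y Q1.I_l_closed by auto
  have "(t \<oplus> \<ominus> (r \<otimes> y)) \<otimes> y [^] n = t \<otimes> y [^] n \<oplus> \<ominus> (r \<otimes> y [^] Suc n)"
  proof -
    have "t \<in> carrier R" "y [^] n \<in> carrier R" "r \<otimes> y \<in> carrier R" using t(1,3) yR by auto
    then have "(t \<oplus> \<ominus> (r \<otimes> y)) \<otimes> y [^] n = t \<otimes> y [^] n \<oplus> \<ominus> (r \<otimes> y \<otimes> y [^] n)"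
      by (simp add: l_distr l_minus)
    also have "r \<otimes> y \<otimes> y [^] n = r \<otimes> y [^] Suc n"
      using t(3) yR by (simp add: m_assoc m_comm[of y])
    finally show ?thesis .
  qed
  also have "\<dots> = q" unfolding t(4) using qR t(3) yR by (simp add: a_assoc r_neg)
  finally have "(t \<oplus> \<ominus> (r \<otimes> y)) \<otimes> y [^] n \<in> Q0" using t by simp
  moreover have "t \<oplus> \<ominus> (r \<otimes> y) \<notin> Q1"
  proof
    assume "t \<oplus> \<ominus> (r \<otimes> y) \<in> Q1"
    then have "(t \<oplus> \<ominus> (r \<otimes> y)) \<oplus> r \<otimes> y \<in> Q1" using ry by (rule Q1.a_closed)
    then show False using t(1,3) yR by (simp add: a_assoc l_neg)
  qed
  ultimately have "y [^] n \<in> Q0"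
    using Q0.I_prime[of "t \<oplus> \<ominus> (r \<otimes> y)" "y [^] n"] t(1,3) yR assms(4) by auto
  then show False using prime_radical[OF Q0 yR] y by blast
qed

end

definition prime_chain :: "('a, 'b) ring_scheme \<Rightarrow> nat \<Rightarrow> (nat \<Rightarrow> 'a set) \<Rightarrow> bool" where
  "prime_chain R k P \<longleftrightarrow> (\<forall>i\<le>k. primeideal (P i) R) \<and> (\<forall>i<k. P i \<subset> P (Suc i))"

lemma prime_chain_append:
  assumes "prime_chain R k P" "primeideal Q R" "P k \<subset> Q"
  shows "prime_chain R (Suc k) (P(Suc k := Q))"
  using assms by (auto simp: prime_chain_def less_Suc_eq le_Suc_eq)

context noetherian_cring
begin

text \<open>From the top downwards, each prime of the chain is replaced by one that contains \<open>x\<close>. At the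
  bottom one step of the chain is lost.\<close>

lemma prime_chain_through_element:
  assumes "prime_chain R (Suc k) P" "x \<in> P (Suc k)"
  shows "\<exists>P'. prime_chain R k P' \<and> P' k = P (Suc k) \<and> P 0 \<subseteq> P' 0 \<and> x \<in> P' 0"
  using assms
proof (induction k arbitrary: P)
  case 0
  then show ?case by (intro exI[of _ "\<lambda>_. P (Suc 0)"]) (auto simp: prime_chain_def)
next
  case (Suc k)
  have prime: "primeideal (P i) R" if "i \<le> Suc (Suc k)" for i
    using Suc.prems that by (auto simp: prime_chain_def)
  have strict: "P i \<subset> P (Suc i)" if "i < Suc (Suc k)" for i
    using Suc.prems that by (auto simp: prime_chain_def)
  obtain Q where Q: "primeideal Q R" "P k \<subset> Q" "Q \<subset> P (Suc (Suc k))" "x \<in> Q"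
    using exists_prime_between_containing
      [OF prime[of k] prime[of "Suc k"] prime[of "Suc (Suc k)"] strict[of k] strict[of "Suc k"] Suc.prems(2)]
    by auto
  have "prime_chain R k P" using Suc.prems by (auto simp: prime_chain_def)
  then have "prime_chain R (Suc k) (P(Suc k := Q))" using prime_chain_append Q by blast
  then obtain P' where P': "prime_chain R k P'" "P' k = Q" "P 0 \<subseteq> P' 0" "x \<in> P' 0"
    using Suc.IH[of "P(Suc k := Q)"] Q(4) unfolding fun_upd_same fun_upd_other[OF nat.distinct(1)]
    by blast
  have "prime_chain R (Suc k) (P'(Suc k := P (Suc (Suc k))))"
    using prime_chain_append[OF P'(1) prime] P'(2) Q by blast
  then show ?case using P' by (intro exI[of _ "P'(Suc k := P (Suc (Suc k)))"])
    (simp del: fun_upd_apply add: fun_upd_same fun_upd_other)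
qed

lemma prime_chain_through_set:
  assumes "finite A" "prime_chain R (k + card A) P" "A \<subseteq> P (k + card A)"
  shows "\<exists>P'. prime_chain R k P' \<and> P' k = P (k + card A) \<and> A \<subseteq> P' 0"
  using assms
proof (induction A arbitrary: k)
  case (insert x A)
  then obtain P' where P': "prime_chain R (Suc k) P'" "P' (Suc k) = P (Suc k + card A)" "A \<subseteq> P' 0"
    using insert.IH[of "Suc k"] by auto
  then obtain P'' where "prime_chain R k P''" "P'' k = P' (Suc k)" "P' 0 \<subseteq> P'' 0" "x \<in> P'' 0"
    using prime_chain_through_element[OF P'(1), of x] insert by auto
  then show ?case using P' insert by (intro exI[of _ P'']) auto
qed auto

text \<open>Krull's height theorem for a prime \<open>P k\<close> that is the only prime over \<open>A\<close>. The elements of \<open>A\<close> are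
  absorbed into the bottom of the chain at the cost of one step each; a chain that contains \<open>A\<close>
  throughout has no steps at all.\<close>

theorem prime_chain_length_le:
  assumes "finite A" "A \<subseteq> P k" "prime_chain R k P"
    and "\<And>Q. primeideal Q R \<Longrightarrow> A \<subseteq> Q \<Longrightarrow> Q = P k"
  shows "k \<le> card A"
proof (rule ccontr)
  assume "\<not> k \<le> card A"
  then obtain l where l: "k = Suc l + card A"
    by (metis add.commute add_Suc_right less_iff_Suc_add not_le)
  then obtain P' where P': "prime_chain R (Suc l) P'" "P' (Suc l) = P k" "A \<subseteq> P' 0"
    using prime_chain_through_set[OF assms(1), of "Suc l" P] assms by auto
  have "P' 0 \<subset> P' 1" using P' by (auto simp: prime_chain_def)
  moreover have "primeideal (P' 0) R" "primeideal (P' 1) R" using P' by (auto simp: prime_chain_def)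
  ultimately have "P' 0 = P k" "P' 1 = P k"
    using assms(4)[of "P' 0"] assms(4)[of "P' 1"] P'(3) by blast+
  with \<open>P' 0 \<subset> P' 1\<close> show False by simp
qed

end

section \<open>Koszul syzygies\<close>

declare Pi_iff [simp]

text \<open>Families indexed by all natural numbers, so that one module serves every finite index set
  \<open>B\<close>: the syzygies of \<open>(x i)\<close> for \<open>i \<in> B\<close> constrain only the coordinates in \<open>B\<close>.\<close>

definition fun_module :: "('a, 'b) ring_scheme \<Rightarrow> ('a, nat \<Rightarrow> 'a) module" where
  "fun_module R =
     \<lparr>carrier = UNIV \<rightarrow> carrier R, monoid.mult = undefined, one = undefined,
      ring.zero = (\<lambda>_. \<zero>\<^bsub>R\<^esub>), ring.add = (\<lambda>v w i. v i \<oplus>\<^bsub>R\<^esub> w i),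
      smult = (\<lambda>r v i. r \<otimes>\<^bsub>R\<^esub> v i)\<rparr>"

lemma fun_module_simps [simp]:
  "carrier (fun_module R) = UNIV \<rightarrow> carrier R"
  "ring.zero (fun_module R) = (\<lambda>_. \<zero>\<^bsub>R\<^esub>)"
  "ring.add (fun_module R) = (\<lambda>v w i. v i \<oplus>\<^bsub>R\<^esub> w i)"
  "smult (fun_module R) = (\<lambda>r v i. r \<otimes>\<^bsub>R\<^esub> v i)"
  by (simp_all add: fun_module_def)

definition linear_form :: "('a, 'b) ring_scheme \<Rightarrow> nat set \<Rightarrow> (nat \<Rightarrow> 'a) \<Rightarrow> (nat \<Rightarrow> 'a) \<Rightarrow> 'a" where
  "linear_form R B x a = (\<Oplus>\<^bsub>R\<^esub>i\<in>B. a i \<otimes>\<^bsub>R\<^esub> x i)"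

definition span_ideal :: "('a, 'b) ring_scheme \<Rightarrow> nat set \<Rightarrow> (nat \<Rightarrow> 'a) \<Rightarrow> 'a set" where
  "span_ideal R B x = linear_form R B x ` (UNIV \<rightarrow> carrier R)"

definition syzygies :: "('a, 'b) ring_scheme \<Rightarrow> nat set \<Rightarrow> (nat \<Rightarrow> 'a) \<Rightarrow> (nat \<Rightarrow> 'a) set" where
  "syzygies R B x = {a \<in> UNIV \<rightarrow> carrier R. linear_form R B x a = \<zero>\<^bsub>R\<^esub>}"

definition alternating :: "('a, 'b) ring_scheme \<Rightarrow> (nat \<Rightarrow> nat \<Rightarrow> 'a) \<Rightarrow> bool" where
  "alternating R b \<longleftrightarrow> (\<forall>i j. b i j \<in> carrier R) \<and> (\<forall>i. b i i = \<zero>\<^bsub>R\<^esub>) \<and>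
     (\<forall>i j. b i j = \<ominus>\<^bsub>R\<^esub> b j i)"

lemma alternatingI:
  assumes "\<And>i j. b i j \<in> carrier R" "\<And>i. b i i = \<zero>\<^bsub>R\<^esub>" "\<And>i j. b i j = \<ominus>\<^bsub>R\<^esub> b j i"
  shows "alternating R b"
  unfolding alternating_def using assms by blast

lemma alternatingD:
  assumes "alternating R b"
  shows "b i j \<in> carrier R" "b i i = \<zero>\<^bsub>R\<^esub>" "b i j = \<ominus>\<^bsub>R\<^esub> b j i"
  using assms unfolding alternating_def by blast+

text \<open>These are the boundaries of degree one in the Koszul complex: an alternating matrix is an element of the
  second exterior power of the free module with basis \<open>B\<close>, and the differential applies it to \<open>x\<close>.\<close>

definition koszul_syzygies :: "('a, 'b) ring_scheme \<Rightarrow> nat set \<Rightarrow> (nat \<Rightarrow> 'a) \<Rightarrow> (nat \<Rightarrow> 'a) set" where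
  "koszul_syzygies R B x = {a \<in> UNIV \<rightarrow> carrier R.
     \<exists>b. alternating R b \<and> (\<forall>i\<in>B. a i = linear_form R B x (b i))}"

context cring
begin

lemma module_fun_module: "module R (fun_module R)"
proof (rule moduleI)
  show "abelian_group (fun_module R)"
  proof (rule abelian_groupI)
    fix v assume "v \<in> carrier (fun_module R)"
    then have "(\<lambda>i. \<ominus> v i) \<in> carrier (fun_module R)"
        "(\<lambda>i. \<ominus> v i) \<oplus>\<^bsub>fun_module R\<^esub> v = \<zero>\<^bsub>fun_module R\<^esub>"
      by (auto simp: Pi_iff l_neg)
    then show "\<exists>w\<in>carrier (fun_module R). w \<oplus>\<^bsub>fun_module R\<^esub> v = \<zero>\<^bsub>fun_module R\<^esub>"
      by blast
  qed (auto simp: Pi_iff a_assoc intro: a_comm)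
qed (auto simp: Pi_iff l_distr r_distr m_assoc is_cring)

lemma submodule_fun_moduleI:
  assumes "L \<subseteq> UNIV \<rightarrow> carrier R" "(\<lambda>_. \<zero>) \<in> L"
    and "\<And>v w. v \<in> L \<Longrightarrow> w \<in> L \<Longrightarrow> (\<lambda>i. v i \<oplus> w i) \<in> L"
    and "\<And>r v. r \<in> carrier R \<Longrightarrow> v \<in> L \<Longrightarrow> (\<lambda>i. r \<otimes> v i) \<in> L"
  shows "submodule L R (fun_module R)"
proof -
  interpret M: module R "fun_module R" by (rule module_fun_module)
  show ?thesis
  proof (rule M.submoduleI)
    fix v assume v: "v \<in> L"
    then have "v \<in> carrier (fun_module R)" using assms(1) by auto
    then have "\<ominus>\<^bsub>fun_module R\<^esub> v = (\<ominus> \<one>) \<odot>\<^bsub>fun_module R\<^esub> v"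
      using M.smult_l_minus[of \<one> v] M.smult_one by simp
    then show "\<ominus>\<^bsub>fun_module R\<^esub> v \<in> L" using assms(4)[OF _ v, of "\<ominus> \<one>"] by simp
  qed (use assms in auto)
qed

lemma linear_form_closed:
  "x \<in> B \<rightarrow> carrier R \<Longrightarrow> a \<in> B \<rightarrow> carrier R \<Longrightarrow> linear_form R B x a \<in> carrier R"
  unfolding linear_form_def by (intro finsum_closed) auto

lemma linear_form_cong:
  assumes "x \<in> B \<rightarrow> carrier R" "a' \<in> B \<rightarrow> carrier R" "\<And>i. i \<in> B \<Longrightarrow> a i = a' i"
  shows "linear_form R B x a = linear_form R B x a'"
  unfolding linear_form_def using assms by (intro finsum_cong') auto

lemma linear_form_add:
  assumes "x \<in> B \<rightarrow> carrier R" "a \<in> B \<rightarrow> carrier R" "b \<in> B \<rightarrow> carrier R"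
  shows "linear_form R B x (\<lambda>i. a i \<oplus> b i) = linear_form R B x a \<oplus> linear_form R B x b"
proof -
  have "(\<Oplus>i\<in>B. (a i \<oplus> b i) \<otimes> x i) = (\<Oplus>i\<in>B. a i \<otimes> x i \<oplus> b i \<otimes> x i)"
    using assms by (intro finsum_cong') (auto simp: Pi_iff l_distr)
  also have "\<dots> = (\<Oplus>i\<in>B. a i \<otimes> x i) \<oplus> (\<Oplus>i\<in>B. b i \<otimes> x i)"
    using assms by (intro finsum_addf) auto
  finally show ?thesis by (simp add: linear_form_def)
qed

lemma linear_form_smult:
  assumes "finite B" "x \<in> B \<rightarrow> carrier R" "a \<in> B \<rightarrow> carrier R" "r \<in> carrier R"
  shows "linear_form R B x (\<lambda>i. r \<otimes> a i) = r \<otimes> linear_form R B x a"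
proof -
  have "(\<Oplus>i\<in>B. (r \<otimes> a i) \<otimes> x i) = (\<Oplus>i\<in>B. r \<otimes> (a i \<otimes> x i))"
    using assms by (intro finsum_cong') (auto simp: Pi_iff m_assoc)
  also have "\<dots> = r \<otimes> (\<Oplus>i\<in>B. a i \<otimes> x i)"
    using assms by (intro finsum_rdistr[symmetric]) auto
  finally show ?thesis by (simp add: linear_form_def)
qed

lemma linear_form_zero: "x \<in> B \<rightarrow> carrier R \<Longrightarrow> linear_form R B x (\<lambda>_. \<zero>) = \<zero>"
  unfolding linear_form_def by (rule add.finprod_one_eqI) (auto simp: Pi_iff)

lemma linear_form_insert:
  assumes "finite B" "p \<notin> B" "x \<in> insert p B \<rightarrow> carrier R" "a \<in> insert p B \<rightarrow> carrier R"
  shows "linear_form R (insert p B) x a = a p \<otimes> x p \<oplus> linear_form R B x a"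
  unfolding linear_form_def using assms by (intro finsum_insert) auto

lemma linear_form_mem_ideal:
  assumes "finite B" "ideal J R" "x \<in> B \<rightarrow> J" "a \<in> B \<rightarrow> carrier R"
  shows "linear_form R B x a \<in> J"
proof -
  interpret J: ideal J R by fact
  have x: "x \<in> B \<rightarrow> carrier R" using assms(3) J.Icarr by auto
  show ?thesis using assms(1,3,4) x
  proof (induction B)
    case empty
    then show ?case by (simp add: linear_form_def J.zero_closed)
  next
    case (insert p B)
    have "linear_form R B x a \<in> J" using insert by auto
    then show ?case
      using insert.prems insert.hyps J.I_l_closed J.a_closed by (auto simp: linear_form_insert)
  qed
qed

lemma linear_form_unit:
  assumes "finite B" "x \<in> B \<rightarrow> carrier R" "p \<in> B"
  shows "linear_form R B x (\<lambda>i. if i = p then \<one> else \<zero>) = x p"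
proof -
  let ?e = "\<lambda>i. if i = p then \<one> else \<zero>"
  have "linear_form R B x ?e = linear_form R (insert p (B - {p})) x ?e"
    using assms(3) by (simp add: insert_absorb)
  also have "\<dots> = ?e p \<otimes> x p \<oplus> linear_form R (B - {p}) x ?e"
    using assms by (intro linear_form_insert) auto
  also have "linear_form R (B - {p}) x ?e = linear_form R (B - {p}) x (\<lambda>_. \<zero>)"
    using assms by (intro linear_form_cong) auto
  also have "\<dots> = \<zero>" using assms by (intro linear_form_zero) auto
  finally show ?thesis using assms by auto
qed

lemma span_ideal_eq_Idl:
  assumes "finite B" "x \<in> B \<rightarrow> carrier R"
  shows "span_ideal R B x = Idl (x ` B)"
proof
  have xR: "x ` B \<subseteq> carrier R" using assms by auto
  have "x \<in> B \<rightarrow> Idl (x ` B)" using genideal_self[OF xR] by auto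
  then show "span_ideal R B x \<subseteq> Idl (x ` B)"
    using linear_form_mem_ideal[OF assms(1) genideal_ideal[OF xR]] by (auto simp: span_ideal_def)
  have sub: "span_ideal R B x \<subseteq> carrier R"
    using linear_form_closed[OF assms(2)] by (auto simp: span_ideal_def)
  have l: "r \<otimes> v \<in> span_ideal R B x" if v: "v \<in> span_ideal R B x" and r: "r \<in> carrier R" for v r
  proof -
    obtain a where a: "a \<in> UNIV \<rightarrow> carrier R" "v = linear_form R B x a"
      using v by (auto simp: span_ideal_def)
    then have "r \<otimes> v = linear_form R B x (\<lambda>i. r \<otimes> a i)"
      using linear_form_smult[OF assms _ r, of a] by auto
    moreover have "(\<lambda>i. r \<otimes> a i) \<in> UNIV \<rightarrow> carrier R" using a r by auto
    ultimately show ?thesis by (simp add: span_ideal_def)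
  qed
  have "ideal (span_ideal R B x) R"
  proof (rule idealI)
    show "subgroup (span_ideal R B x) (add_monoid R)"
    proof (rule add.subgroupI)
      show "span_ideal R B x \<noteq> {}" by (auto simp: span_ideal_def)
      show "\<ominus> v \<in> span_ideal R B x" if "v \<in> span_ideal R B x" for v
        using l[OF that, of "\<ominus> \<one>"] that sub by (auto simp: l_minus)
      fix v w assume "v \<in> span_ideal R B x" "w \<in> span_ideal R B x"
      then obtain a b where a: "a \<in> UNIV \<rightarrow> carrier R" "v = linear_form R B x a"
          and b: "b \<in> UNIV \<rightarrow> carrier R" "w = linear_form R B x b"
        by (auto simp: span_ideal_def)
      have "v \<oplus> w = linear_form R B x (\<lambda>i. a i \<oplus> b i)"
        unfolding a(2) b(2) using a(1) b(1) by (intro linear_form_add[OF assms(2), symmetric]) auto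
      moreover have "(\<lambda>i. a i \<oplus> b i) \<in> UNIV \<rightarrow> carrier R" using a b by auto
      ultimately show "v \<oplus> w \<in> span_ideal R B x" by (simp add: span_ideal_def)
    qed (rule sub)
    show "v \<otimes> r \<in> span_ideal R B x" if "v \<in> span_ideal R B x" "r \<in> carrier R" for v r
      using l[OF that] that sub by (auto simp: m_comm)
  qed (use l ring_axioms in auto)
  moreover have "x ` B \<subseteq> span_ideal R B x"
  proof
    fix v assume "v \<in> x ` B"
    then obtain p where p: "p \<in> B" "v = x p" by blast
    have "(\<lambda>i. if i = p then \<one> else \<zero>) \<in> UNIV \<rightarrow> carrier R" by auto
    then show "v \<in> span_ideal R B x"
      using linear_form_unit[OF assms p(1)] p(2) unfolding span_ideal_def by (metis image_eqI)
  qed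
  ultimately show "Idl (x ` B) \<subseteq> span_ideal R B x" by (rule genideal_minimal)
qed

lemma submodule_syzygies:
  assumes "finite B" "x \<in> B \<rightarrow> carrier R"
  shows "submodule (syzygies R B x) R (fun_module R)"
proof (rule submodule_fun_moduleI)
  show "(\<lambda>_. \<zero>) \<in> syzygies R B x" using linear_form_zero[OF assms(2)] by (auto simp: syzygies_def)
  show "(\<lambda>i. v i \<oplus> w i) \<in> syzygies R B x" if "v \<in> syzygies R B x" "w \<in> syzygies R B x" for v w
    using that linear_form_add[OF assms(2), of v w] by (auto simp: syzygies_def Pi_iff)
  show "(\<lambda>i. r \<otimes> v i) \<in> syzygies R B x" if "r \<in> carrier R" "v \<in> syzygies R B x" for r v
    using that linear_form_smult[OF assms, of v r] by (auto simp: syzygies_def Pi_iff)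
qed (auto simp: syzygies_def)

lemma koszul_syzygiesI:
  assumes "a \<in> UNIV \<rightarrow> carrier R" "alternating R b"
    and "\<And>i. i \<in> B \<Longrightarrow> a i = linear_form R B x (b i)"
  shows "a \<in> koszul_syzygies R B x"
  using assms by (auto simp: koszul_syzygies_def)

lemma submodule_koszul_syzygies:
  assumes "finite B" "x \<in> B \<rightarrow> carrier R"
  shows "submodule (koszul_syzygies R B x) R (fun_module R)"
proof (rule submodule_fun_moduleI)
  show "(\<lambda>_. \<zero>) \<in> koszul_syzygies R B x"
    using linear_form_zero[OF assms(2)]
    by (intro koszul_syzygiesI[where b = "\<lambda>_ _. \<zero>"] alternatingI) auto
next
  fix v w assume "v \<in> koszul_syzygies R B x" "w \<in> koszul_syzygies R B x"
  then obtain b c where v: "v \<in> UNIV \<rightarrow> carrier R" "alternating R b" "\<forall>i\<in>B. v i = linear_form R B x (b i)"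
      and w: "w \<in> UNIV \<rightarrow> carrier R" "alternating R c" "\<forall>i\<in>B. w i = linear_form R B x (c i)"
    unfolding koszul_syzygies_def by blast
  have R: "b i j \<in> carrier R" "c i j \<in> carrier R" for i j
    using v(2) w(2) by (auto intro: alternatingD)
  show "(\<lambda>i. v i \<oplus> w i) \<in> koszul_syzygies R B x"
  proof (rule koszul_syzygiesI[where b = "\<lambda>i j. b i j \<oplus> c i j"])
    show "(\<lambda>i. v i \<oplus> w i) \<in> UNIV \<rightarrow> carrier R" using v w by auto
    have skew: "b i j \<oplus> c i j = \<ominus> (b j i \<oplus> c j i)" for i j
    proof -
      have "b i j = \<ominus> b j i" "c i j = \<ominus> c j i"
        by (fact alternatingD(3)[OF v(2)], fact alternatingD(3)[OF w(2)])
      then show ?thesis using R by (simp add: minus_add)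
    qed
    show "alternating R (\<lambda>i j. b i j \<oplus> c i j)"
      by (rule alternatingI[OF _ _ skew])
        (simp_all add: R alternatingD(2)[OF v(2)] alternatingD(2)[OF w(2)])
    show "v i \<oplus> w i = linear_form R B x (\<lambda>j. b i j \<oplus> c i j)" if "i \<in> B" for i
      using v(3) w(3) that R linear_form_add[OF assms(2), of "b i" "c i"] by auto
  qed
next
  fix r v assume r: "r \<in> carrier R" and "v \<in> koszul_syzygies R B x"
  then obtain b where v: "v \<in> UNIV \<rightarrow> carrier R" "alternating R b" "\<forall>i\<in>B. v i = linear_form R B x (b i)"
    unfolding koszul_syzygies_def by blast
  have R: "b i j \<in> carrier R" for i j by (rule alternatingD(1)[OF v(2)])
  show "(\<lambda>i. r \<otimes> v i) \<in> koszul_syzygies R B x"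
  proof (rule koszul_syzygiesI[where b = "\<lambda>i j. r \<otimes> b i j"])
    show "(\<lambda>i. r \<otimes> v i) \<in> UNIV \<rightarrow> carrier R" using v r by auto
    have skew: "r \<otimes> b i j = \<ominus> (r \<otimes> b j i)" for i j
    proof -
      have "b i j = \<ominus> b j i" by (rule alternatingD(3)[OF v(2)])
      then show ?thesis using R r by (simp add: r_minus)
    qed
    show "alternating R (\<lambda>i j. r \<otimes> b i j)"
      by (rule alternatingI[OF _ _ skew]) (simp_all add: R r alternatingD(2)[OF v(2)])
    show "r \<otimes> v i = linear_form R B x (\<lambda>j. r \<otimes> b i j)" if "i \<in> B" for i
      using v(3) that R r linear_form_smult[OF assms, of "b i"] by auto
  qed
qed (auto simp: koszul_syzygies_def)

lemma koszul_syzygies_cong: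
  assumes "v \<in> koszul_syzygies R B x" "w \<in> UNIV \<rightarrow> carrier R" "\<And>i. i \<in> B \<Longrightarrow> v i = w i"
  shows "w \<in> koszul_syzygies R B x"
  using assms unfolding koszul_syzygies_def by auto

text \<open>The ideal generated by the \<open>x i\<close> annihilates their first Koszul homology. For \<open>t = \<Sum> r\<^sub>j x\<^sub>j\<close> the
  matrix \<open>v\<^sub>i r\<^sub>j - r\<^sub>i v\<^sub>j\<close> maps \<open>x\<close> to \<open>t v\<close>, because \<open>v\<close> is a syzygy.\<close>

lemma span_ideal_mult_syzygy:
  assumes "finite B" "x \<in> B \<rightarrow> carrier R" "t \<in> span_ideal R B x" "v \<in> syzygies R B x"
  shows "(\<lambda>i. t \<otimes> v i) \<in> koszul_syzygies R B x"
proof -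
  obtain r where r: "r \<in> UNIV \<rightarrow> carrier R" and t: "t = linear_form R B x r"
    using assms(3) by (auto simp: span_ideal_def)
  have rR: "r i \<in> carrier R" and vR: "v i \<in> carrier R" for i
    using r assms(4) by (auto simp: syzygies_def)
  have tR: "t \<in> carrier R" unfolding t using r assms(2) by (intro linear_form_closed) auto
  let ?b = "\<lambda>i j. v i \<otimes> r j \<oplus> \<ominus> r i \<otimes> v j"
  show ?thesis
  proof (rule koszul_syzygiesI[where b = ?b])
    show "(\<lambda>i. t \<otimes> v i) \<in> UNIV \<rightarrow> carrier R" using tR vR by auto
    have skew: "?b i j = \<ominus> ?b j i" for i j
      using rR vR by (simp add: minus_add l_minus r_minus m_comm a_comm)
    have diag: "?b i i = \<zero>" for i
      using rR vR by (simp add: l_minus m_comm[of "v i"] r_neg)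
    show "alternating R ?b"
      by (rule alternatingI[OF _ diag skew]) (simp add: rR vR)
    fix i assume "i \<in> B"
    have "linear_form R B x (?b i) =
        linear_form R B x (\<lambda>j. v i \<otimes> r j) \<oplus> linear_form R B x (\<lambda>j. \<ominus> r i \<otimes> v j)"
      using rR vR by (intro linear_form_add[OF assms(2)]) auto
    also have "\<dots> = v i \<otimes> t \<oplus> \<ominus> r i \<otimes> linear_form R B x v"
      using rR vR linear_form_smult[OF assms(1,2), of r "v i"]
        linear_form_smult[OF assms(1,2), of v "\<ominus> r i"]
      by (simp add: t Pi_iff)
    also have "\<dots> = t \<otimes> v i"
      using assms(4) rR vR tR by (simp add: syzygies_def m_comm)
    finally show "t \<otimes> v i = linear_form R B x (?b i)" by simp
  qed
qed

lemma lin_combs_regular_lift: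
  "r \<in> lin_combs (regular_module R) C (map (\<lambda>v. v p) hs) \<Longrightarrow> \<exists>w\<in>lin_combs (fun_module R) C hs. w p = r"
proof (induction hs arbitrary: r)
  case (Cons h hs)
  then obtain a u where r: "r = a \<otimes> h p \<oplus> u" "a \<in> C"
      "u \<in> lin_combs (regular_module R) C (map (\<lambda>v. v p) hs)"
    by auto
  then obtain w where w: "w \<in> lin_combs (fun_module R) C hs" "w p = u" using Cons.IH by blast
  have "(\<lambda>i. a \<otimes> h i \<oplus> w i) \<in> lin_combs (fun_module R) C (h # hs)"
    using w(1) r(2) by auto
  then show ?case using w(2) r(1) by (intro bexI[of _ "\<lambda>i. a \<otimes> h i \<oplus> w i"]) auto
qed simp

end

context noetherian_cring
begin

text \<open>A free module of finite rank over a Noetherian ring is Noetherian. The coordinates at \<open>p\<close> of the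
  elements of \<open>L\<close> form a finitely generated ideal; lifts of its generators reduce any element of \<open>L\<close> to one whose
  coordinate at \<open>p\<close> vanishes.\<close>

lemma submodule_fun_module_finitely_generated:
  assumes "finite B" "submodule L R (fun_module R)"
  shows "\<exists>gs. set gs \<subseteq> L \<and>
    (\<forall>v\<in>L. \<exists>w\<in>lin_combs (fun_module R) (carrier R) gs. \<forall>i\<in>B. v i = w i)"
  using assms
proof (induction B arbitrary: L)
  case empty
  then show ?case by (intro exI[of _ "[]"]) auto
next
  case (insert p B)
  interpret M: module R "fun_module R" by (rule module_fun_module)
  note L = M.submoduleE[OF insert.prems]
  have LR: "v i \<in> carrier R" if "v \<in> L" for v i using L(1) that by auto
  have zeroL: "(\<lambda>_. \<zero>) \<in> L"
  proof -
    obtain v where "v \<in> L" using L(2) by blast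
    then show ?thesis using L(4)[of \<zero> v] LR by simp
  qed
  have addL: "(\<lambda>i. v i \<oplus> w i) \<in> L" if "v \<in> L" "w \<in> L" for v w using L(5)[OF that] by simp
  have smultL: "(\<lambda>i. r \<otimes> v i) \<in> L" if "v \<in> L" "r \<in> carrier R" for v r
    using L(4)[OF that(2,1)] by simp
  let ?E = "(\<lambda>v. v p) ` L"
  have smultE: "r \<otimes> e \<in> ?E" if "e \<in> ?E" "r \<in> carrier R" for e r
    using that smultL by (auto intro!: image_eqI[where x = "\<lambda>i. r \<otimes> _ i"])
  have "ideal ?E R"
  proof (rule idealI)
    show "subgroup ?E (add_monoid R)"
    proof (rule add.subgroupI)
      show "?E \<subseteq> carrier R" using LR by auto
      show "?E \<noteq> {}" using zeroL by auto
      show "\<ominus> e \<in> ?E" if "e \<in> ?E" for e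
        using smultE[OF that, of "\<ominus> \<one>"] that LR by (auto simp: l_minus)
      show "e \<oplus> f \<in> ?E" if "e \<in> ?E" "f \<in> ?E" for e f
        using that addL by (auto intro!: image_eqI[where x = "\<lambda>i. _ i \<oplus> _ i"])
    qed
    show "e \<otimes> r \<in> ?E" if "e \<in> ?E" "r \<in> carrier R" for e r
      using smultE[OF that] that LR by (auto simp: m_comm)
  qed (use smultE ring_axioms in auto)
  then obtain rs where rs: "set rs \<subseteq> carrier R" "?E = Idl (set rs)"
    by (rule exists_generating_list)
  then have "set rs \<subseteq> ?E" using genideal_self[OF rs(1)] by simp
  then have "\<forall>r\<in>set rs. \<exists>v\<in>L. v p = r" by (auto simp: image_iff subset_iff)
  then obtain f where f: "\<forall>r\<in>set rs. f r \<in> L \<and> f r p = r" by metis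
  define hs where "hs = map f rs"
  have hsL: "set hs \<subseteq> L" using f by (auto simp: hs_def)
  have hs_p: "map (\<lambda>v. v p) hs = rs" using f by (simp add: hs_def map_idI)
  let ?L0 = "{v \<in> L. v p = \<zero>}"
  have "submodule ?L0 R (fun_module R)"
    using zeroL addL smultL LR by (intro submodule_fun_moduleI) auto
  then obtain gs where gs: "set gs \<subseteq> ?L0"
    and gen: "\<forall>v\<in>?L0. \<exists>w\<in>lin_combs (fun_module R) (carrier R) gs. \<forall>i\<in>B. v i = w i"
    using insert.IH by blast
  have gsL: "lin_combs (fun_module R) (carrier R) gs \<subseteq> ?L0"
    using M.lin_combs_subset_submodule[OF \<open>submodule ?L0 R (fun_module R)\<close> gs] by simp
  have gsM: "set gs \<subseteq> carrier (fun_module R)" "set hs \<subseteq> carrier (fun_module R)"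
    using gs hsL L(1) by auto
  show ?case
  proof (intro exI[of _ "hs @ gs"] conjI ballI)
    show "set (hs @ gs) \<subseteq> L" using gs hsL by auto
    fix v assume v: "v \<in> L"
    then have "v p \<in> lin_combs (regular_module R) (carrier R) (map (\<lambda>v. v p) hs)"
      using rs lin_combs_regular_eq_Idl[OF rs(1)] hs_p by auto
    then obtain w where w: "w \<in> lin_combs (fun_module R) (carrier R) hs" "w p = v p"
      using lin_combs_regular_lift by blast
    have wL: "w \<in> L"
      using M.lin_combs_subset_submodule[OF insert.prems hsL] w(1) by blast
    define d where "d i = v i \<oplus> (\<ominus> \<one>) \<otimes> w i" for i
    have "d \<in> L" using addL[OF v smultL[OF wL, of "\<ominus> \<one>"]]
      by (simp add: d_def[abs_def])
    moreover have "d p = \<zero>" using w(2) LR[OF v] by (simp add: d_def l_minus r_neg)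
    ultimately obtain u where u: "u \<in> lin_combs (fun_module R) (carrier R) gs"
        "\<forall>i\<in>B. d i = u i"
      using gen by blast
    have uR: "u i \<in> carrier R" and up: "u p = \<zero>" for i using gsL u(1) LR by auto
    have "(\<lambda>i. w i \<oplus> u i) \<in> lin_combs (fun_module R) (carrier R) (hs @ gs)"
      using M.lin_combs_append[OF gsM(2,1) _ w(1) u(1)] by simp
    moreover have "v i = w i \<oplus> u i" if "i \<in> insert p B" for i
    proof (cases "i = p")
      case True
      then show ?thesis using up w(2) LR[OF v] by simp
    next
      case False
      then have "u i = v i \<oplus> (\<ominus> \<one>) \<otimes> w i" using u(2) that by (auto simp: d_def)
      then show ?thesis
        using LR[OF v, of i] LR[OF wL, of i] by (simp add: l_minus a_lcomm[of "w i"] r_neg)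
    qed
    ultimately show "\<exists>w\<in>lin_combs (fun_module R) (carrier R) (hs @ gs). \<forall>i\<in>insert p B. v i = w i"
      by (intro bexI[of _ "\<lambda>i. w i \<oplus> u i"]) simp_all
  qed
qed

text \<open>Nakayama's lemma at \<open>P\<close> for the module \<open>c H\<^sub>1(x)\<close>, which is finitely generated by the classes of \<open>c g\<close> for
  generators \<open>g\<close> of the syzygies.\<close>

lemma koszul_nakayama:
  assumes P: "primeideal P R" and B: "finite B" "x \<in> B \<rightarrow> carrier R" and c: "c \<in> carrier R"
    and rows: "\<And>a. a \<in> syzygies R B x \<Longrightarrow>
      \<exists>s\<in>carrier R - P. \<exists>y\<in>P. \<exists>b\<in>syzygies R B x. \<exists>k\<in>koszul_syzygies R B x.
        \<forall>i. s \<otimes> (c \<otimes> a i) = k i \<oplus> y \<otimes> (c \<otimes> b i)"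
  shows "\<exists>s\<in>carrier R - P. \<forall>a\<in>syzygies R B x. (\<lambda>i. (s \<otimes> c) \<otimes> a i) \<in> koszul_syzygies R B x"
proof -
  interpret M: module R "fun_module R" by (rule module_fun_module)
  interpret P: primeideal P R by fact
  note N = submodule_koszul_syzygies[OF B]
  note Z = submodule_syzygies[OF B]
  note NE = M.submoduleE[OF N] and ZE = M.submoduleE[OF Z]
  have PR: "P \<subseteq> carrier R" using P.Icarr by blast
  obtain gs where gs: "set gs \<subseteq> syzygies R B x"
    and gen: "\<forall>v\<in>syzygies R B x. \<exists>w\<in>lin_combs (fun_module R) (carrier R) gs. \<forall>i\<in>B. v i = w i"
    using submodule_fun_module_finitely_generated[OF B(1) Z] by blast
  have gsM: "set gs \<subseteq> carrier (fun_module R)" using gs ZE(1) by blast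
  define hs where "hs = map (\<lambda>g. c \<odot>\<^bsub>fun_module R\<^esub> g) gs"
  have hsM: "set hs \<subseteq> carrier (fun_module R)" using gsM c by (auto simp: hs_def)
  have "\<exists>s\<in>carrier R - P. \<forall>h\<in>set hs. s \<odot>\<^bsub>fun_module R\<^esub> h \<in> koszul_syzygies R B x"
  proof (rule M.nakayama_at_prime[OF N P hsM], rule ballI)
    fix h assume "h \<in> set hs"
    then obtain g where g: "g \<in> set gs" and h: "h = (\<lambda>i. c \<otimes> g i)" by (auto simp: hs_def)
    obtain s y b k where s: "s \<in> carrier R - P" and y: "y \<in> P" and b: "b \<in> syzygies R B x"
      and k: "k \<in> koszul_syzygies R B x" and eq: "\<And>i. s \<otimes> (c \<otimes> g i) = k i \<oplus> y \<otimes> (c \<otimes> b i)"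
      using rows[of g] g gs by blast
    obtain w where w: "w \<in> lin_combs (fun_module R) (carrier R) gs" and bw: "\<forall>i\<in>B. b i = w i"
      using gen b by blast
    have wM: "w \<in> carrier (fun_module R)" using M.lin_combs_closed[OF _ gsM] w by blast
    have R: "b i \<in> carrier R" "w i \<in> carrier R" "k i \<in> carrier R" "y \<in> carrier R" for i
      using b ZE(1) wM k NE(1) y PR by (auto simp: Pi_iff)
    have "y \<odot>\<^bsub>fun_module R\<^esub> (c \<odot>\<^bsub>fun_module R\<^esub> w) \<in> lin_combs (fun_module R) P hs"
    proof (rule M.lin_combs_smult[OF order_refl hsM R(4)])
      show "y \<otimes> a \<in> P" if "a \<in> carrier R" for a by (rule P.I_r_closed[OF y that])
      show "c \<odot>\<^bsub>fun_module R\<^esub> w \<in> lin_combs (fun_module R) (carrier R) hs"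
        unfolding hs_def by (rule M.lin_combs_map_smult[OF gsM order_refl c w])
    qed
    \<comment> \<open>\<open>b\<close> and \<open>w\<close> agree on \<open>B\<close> only; their difference vanishes on \<open>B\<close> and is therefore Koszul\<close>
    moreover define k' where "k' i = k i \<oplus> y \<otimes> (c \<otimes> (b i \<oplus> \<ominus> w i))" for i
    have "k' \<in> koszul_syzygies R B x"
      using R c bw by (intro koszul_syzygies_cong[OF k]) (auto simp: k'_def r_neg)
    moreover have "s \<odot>\<^bsub>fun_module R\<^esub> h =
        k' \<oplus>\<^bsub>fun_module R\<^esub> y \<odot>\<^bsub>fun_module R\<^esub> (c \<odot>\<^bsub>fun_module R\<^esub> w)"
    proof
      fix i
      have "k' i \<oplus> y \<otimes> (c \<otimes> w i) = k i \<oplus> y \<otimes> (c \<otimes> ((b i \<oplus> \<ominus> w i) \<oplus> w i))"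
        using R c by (simp add: k'_def r_distr a_assoc)
      also have "(b i \<oplus> \<ominus> w i) \<oplus> w i = b i" using R by (simp add: a_assoc l_neg)
      finally show "(s \<odot>\<^bsub>fun_module R\<^esub> h) i =
          (k' \<oplus>\<^bsub>fun_module R\<^esub> y \<odot>\<^bsub>fun_module R\<^esub> (c \<odot>\<^bsub>fun_module R\<^esub> w)) i"
        using eq[of i] by (simp add: h)
    qed
    ultimately show "\<exists>s\<in>carrier R - P. \<exists>n\<in>koszul_syzygies R B x. \<exists>w\<in>lin_combs (fun_module R) P hs.
        s \<odot>\<^bsub>fun_module R\<^esub> h = n \<oplus>\<^bsub>fun_module R\<^esub> w"
      using s by blast
  qed
  then obtain s where s: "s \<in> carrier R - P"
    and kill: "\<forall>h\<in>set hs. s \<odot>\<^bsub>fun_module R\<^esub> h \<in> koszul_syzygies R B x" by blast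
  have sc: "s \<otimes> c \<in> carrier R" using s c by auto
  have gsR: "g i \<in> carrier R" if "g \<in> set gs" for g i using that gsM by auto
  have kill': "\<forall>g\<in>set gs. (s \<otimes> c) \<odot>\<^bsub>fun_module R\<^esub> g \<in> koszul_syzygies R B x"
    using kill s c gsR by (auto simp: hs_def m_assoc)
  have "(\<lambda>i. (s \<otimes> c) \<otimes> a i) \<in> koszul_syzygies R B x" if a: "a \<in> syzygies R B x" for a
  proof -
    obtain w where w: "w \<in> lin_combs (fun_module R) (carrier R) gs" and aw: "\<forall>i\<in>B. a i = w i"
      using gen a by blast
    have "(s \<otimes> c) \<odot>\<^bsub>fun_module R\<^esub> w \<in> koszul_syzygies R B x"
      by (rule M.lin_combs_smult_submodule[OF N _ gsM sc kill' w]) simp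
    then show ?thesis
      using a sc aw by (elim koszul_syzygies_cong) (auto simp: syzygies_def)
  qed
  then show ?thesis using s by blast
qed

lemma syzygy_extend:
  assumes "finite B" "p \<notin> B" "x \<in> insert p B \<rightarrow> carrier R" "a \<in> syzygies R B x"
  shows "a(p := \<zero>) \<in> syzygies R (insert p B) x"
proof -
  have aR: "a i \<in> carrier R" for i using assms(4) by (auto simp: syzygies_def)
  have "linear_form R B x (a(p := \<zero>)) = linear_form R B x a"
    using aR assms(2,3) by (intro linear_form_cong) auto
  then have "linear_form R (insert p B) x (a(p := \<zero>)) = \<zero>"
    using linear_form_insert[OF assms(1-3), of "a(p := \<zero>)"] aR assms(3,4)
    by (auto simp: syzygies_def)
  then show ?thesis using aR by (auto simp: syzygies_def)
qed

text \<open>If an alternating matrix \<open>b\<close> on \<open>insert p B\<close> maps \<open>x\<close> to a vector that vanishes at \<open>p\<close>, its row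
  at \<open>p\<close> is a syzygy on \<open>B\<close>, and so is its column at \<open>p\<close>, which is the negative of this row. The column enters the
  other coordinates with the factor \<open>x p\<close>, and the rest of the matrix contributes a Koszul syzygy on
  \<open>B\<close>.\<close>

lemma koszul_syzygy_restrict:
  assumes "finite B" "p \<notin> B" "x \<in> insert p B \<rightarrow> carrier R" "s \<in> carrier R" "a \<in> syzygies R B x"
    and "(\<lambda>i. s \<otimes> (a(p := \<zero>)) i) \<in> koszul_syzygies R (insert p B) x"
  shows "\<exists>b\<in>syzygies R B x. \<exists>k\<in>koszul_syzygies R B x. \<forall>i. s \<otimes> a i = k i \<oplus> x p \<otimes> b i"
proof -
  have xB: "x \<in> B \<rightarrow> carrier R" and xp: "x p \<in> carrier R" using assms(3) by auto
  have aR: "a i \<in> carrier R" for i using assms(5) by (auto simp: syzygies_def)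
  obtain b where b: "alternating R b"
    and eq: "\<And>i. i \<in> insert p B \<Longrightarrow> s \<otimes> (a(p := \<zero>)) i = linear_form R (insert p B) x (b i)"
    using assms(6) unfolding koszul_syzygies_def by blast
  have bR: "b i j \<in> carrier R" and bii: "b i i = \<zero>" for i j
    by (rule alternatingD(1)[OF b], rule alternatingD(2)[OF b])
  have bij: "b i j = \<ominus> b j i" for i j by (rule alternatingD(3)[OF b])
  have ins: "linear_form R (insert p B) x (b i) = b i p \<otimes> x p \<oplus> linear_form R B x (b i)" for i
    using bR by (intro linear_form_insert[OF assms(1-3)]) auto
  have lR: "linear_form R B x (b i) \<in> carrier R" for i
    using bR by (intro linear_form_closed[OF xB]) auto
  have "linear_form R B x (b p) = \<zero>"
    using eq[of p] ins[of p] assms(4) xp bii lR by simp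
  then have bp: "b p \<in> syzygies R B x" using bR by (auto simp: syzygies_def)
  define b' where "b' i = \<ominus> \<one> \<otimes> b p i" for i
  have b': "b' \<in> syzygies R B x"
    using module.submoduleE(4)[OF module_fun_module submodule_syzygies[OF assms(1) xB] _ bp, of "\<ominus> \<one>"]
    by (simp add: b'_def[abs_def])
  have b'R: "b' i \<in> carrier R" for i using bR by (simp add: b'_def)
  define k where "k i = s \<otimes> a i \<oplus> \<ominus> (x p \<otimes> b' i)" for i
  have "k \<in> koszul_syzygies R B x"
  proof (rule koszul_syzygiesI[OF _ b])
    show "k \<in> UNIV \<rightarrow> carrier R" using aR b'R assms(4) xp by (auto simp: k_def)
    fix i assume i: "i \<in> B"
    then have "i \<noteq> p" using assms(2) by blast
    then have "s \<otimes> a i = b i p \<otimes> x p \<oplus> linear_form R B x (b i)"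
      using eq[of i] ins[of i] i by simp
    moreover have "x p \<otimes> b' i = b i p \<otimes> x p"
      using bij[of i p] bR[of p i] xp by (simp add: b'_def l_minus r_minus m_comm)
    ultimately show "k i = linear_form R B x (b i)"
      using bR xp lR by (simp add: k_def a_comm[of "b i p \<otimes> x p"] a_assoc r_neg)
  qed
  moreover have "s \<otimes> a i = k i \<oplus> x p \<otimes> b' i" for i
    using aR b'R assms(4) xp by (simp add: k_def a_assoc l_neg)
  ultimately show ?thesis using b' by blast
qed

text \<open>The relation \<open>r x\<^sub>p = \<Sum> t\<^sub>i x\<^sub>i\<close> is a syzygy with coordinate \<open>r\<close> at \<open>p\<close>, and the coordinate at \<open>p\<close> of a Koszul
  syzygy lies in the ideal of the other generators because the diagonal of its matrix is zero.\<close>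

lemma koszul_syzygy_colon:
  assumes "finite B" "p \<notin> B" "x \<in> insert p B \<rightarrow> carrier R"
    and "\<And>a. a \<in> syzygies R (insert p B) x \<Longrightarrow>
      \<exists>s\<in>S. (\<lambda>i. s \<otimes> a i) \<in> koszul_syzygies R (insert p B) x"
    and "r \<in> carrier R" "r \<otimes> x p \<in> span_ideal R B x"
  shows "\<exists>s\<in>S. s \<otimes> r \<in> span_ideal R B x"
proof -
  have xB: "x \<in> B \<rightarrow> carrier R" and xp: "x p \<in> carrier R" using assms(3) by auto
  obtain t where t: "t \<in> UNIV \<rightarrow> carrier R" and rt: "r \<otimes> x p = linear_form R B x t"
    using assms(6) by (auto simp: span_ideal_def)
  define a where "a = (\<lambda>i. \<ominus> \<one> \<otimes> t i)(p := r)"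
  have aR: "a i \<in> carrier R" for i using t assms(5) by (auto simp: a_def)
  have tl: "linear_form R B x t \<in> carrier R" using t by (intro linear_form_closed[OF xB]) auto
  have "linear_form R B x a = linear_form R B x (\<lambda>i. \<ominus> \<one> \<otimes> t i)"
    using t assms(2) by (intro linear_form_cong[OF xB]) (auto simp: a_def)
  also have "\<dots> = \<ominus> (r \<otimes> x p)"
    using linear_form_smult[OF assms(1) xB, of t "\<ominus> \<one>"] t tl by (simp add: rt l_minus Pi_iff)
  finally have "linear_form R (insert p B) x a = r \<otimes> x p \<oplus> \<ominus> (r \<otimes> x p)"
    using linear_form_insert[OF assms(1-3), of a] aR assms(5) by (simp add: a_def)
  then have "a \<in> syzygies R (insert p B) x"
    using aR assms(5) xp by (auto simp: syzygies_def r_neg)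
  then obtain s where s: "s \<in> S" "(\<lambda>i. s \<otimes> a i) \<in> koszul_syzygies R (insert p B) x"
    using assms(4) by blast
  then obtain b where b: "alternating R b"
    and eq: "\<And>i. i \<in> insert p B \<Longrightarrow> s \<otimes> a i = linear_form R (insert p B) x (b i)"
    unfolding koszul_syzygies_def by blast
  have bR: "b i j \<in> carrier R" and bii: "b i i = \<zero>" for i j
    by (rule alternatingD(1)[OF b], rule alternatingD(2)[OF b])
  have lR: "linear_form R B x (b p) \<in> carrier R"
    using bR by (intro linear_form_closed[OF xB]) auto
  have "s \<otimes> r = b p p \<otimes> x p \<oplus> linear_form R B x (b p)"
    using eq[of p] linear_form_insert[OF assms(1-3), of "b p"] bR by (simp add: a_def)
  also have "\<dots> = linear_form R B x (b p)" using bii xp lR by simp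
  finally show ?thesis using s(1) bR by (auto simp: span_ideal_def)
qed

section \<open>Vanishing Koszul homology and height\<close>

text \<open>If the first Koszul homology vanishes at \<open>P\<close>, the \<open>x i\<close> form a regular sequence locally at \<open>P\<close>.
  With \<open>A = insert p B\<close>, the element \<open>x p\<close> is locally regular modulo the ideal \<open>J\<close> of the others, so \<open>J\<close>
  avoids all \<open>t x\<^sub>p\<^sup>n\<close> with \<open>t \<notin> P\<close>, and some prime \<open>Q\<close> strictly below \<open>P\<close> contains \<open>J\<close>. The exact sequence
  \<open>H\<^sub>1(B) \<rightarrow> H\<^sub>1(B) \<rightarrow> H\<^sub>1(A)\<close>, whose first map is multiplication by \<open>x p\<close>, and Nakayama's lemma
  show that \<open>H\<^sub>1(B)\<close> vanishes at \<open>P\<close> and hence at \<open>Q\<close>.\<close>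

theorem prime_chain_of_locally_koszul:
  assumes "finite A" "primeideal P R" "x \<in> A \<rightarrow> P"
    and "\<And>a. a \<in> syzygies R A x \<Longrightarrow> \<exists>s\<in>carrier R - P. (\<lambda>i. s \<otimes> a i) \<in> koszul_syzygies R A x"
  shows "\<exists>Q. prime_chain R (card A) Q \<and> Q (card A) = P"
  using assms
proof (induction A arbitrary: P)
  case empty
  then show ?case by (intro exI[of _ "\<lambda>_. P"]) (auto simp: prime_chain_def)
next
  case (insert p B)
  interpret P: primeideal P R by fact
  have xA: "x \<in> insert p B \<rightarrow> carrier R" using insert.prems(2) P.Icarr by auto
  have xB: "x \<in> B \<rightarrow> carrier R" and xp: "x p \<in> carrier R" using xA by auto
  note mult = prime_complement_mult[OF insert.prems(1)]
  note one = prime_complement_one[OF insert.prems(1)]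
  let ?J = "span_ideal R B x"
  have J: "?J = Idl (x ` B)" by (rule span_ideal_eq_Idl[OF insert.hyps(1) xB])
  have J_ideal: "ideal ?J R" unfolding J using xB by (intro genideal_ideal) auto
  have JP: "?J \<subseteq> P"
    unfolding J using insert.prems(2) by (intro genideal_minimal P.is_ideal) auto
  have colon: "\<exists>s\<in>carrier R - P. s \<otimes> r \<in> ?J" if "r \<in> carrier R" "r \<otimes> x p \<in> ?J" for r
    by (rule koszul_syzygy_colon[OF insert.hyps xA insert.prems(3) that])
  have avoid: "t \<otimes> x p [^] (n::nat) \<notin> ?J" if "t \<in> carrier R - P" for t n
    using that
  proof (induction n arbitrary: t)
    case 0
    then show ?case using JP by auto
  next
    case (Suc n)
    show ?case
    proof
      assume "t \<otimes> x p [^] Suc n \<in> ?J"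
      then have "(t \<otimes> x p [^] n) \<otimes> x p \<in> ?J" using Suc.prems xp by (simp add: m_assoc)
      then obtain s where s: "s \<in> carrier R - P" "s \<otimes> (t \<otimes> x p [^] n) \<in> ?J"
        using colon[of "t \<otimes> x p [^] n"] Suc.prems xp by auto
      then have "(s \<otimes> t) \<otimes> x p [^] n \<in> ?J" using Suc.prems xp by (simp add: m_assoc)
      then show False using Suc.IH[OF mult[OF s(1) Suc.prems]] by blast
    qed
  qed
  let ?S = "{t \<otimes> x p [^] n | t (n::nat). t \<in> carrier R - P}"
  obtain Q where Q: "primeideal Q R" "?J \<subseteq> Q" "Q \<inter> ?S = {}"
  proof (rule exists_prime_avoiding[OF J_ideal, of ?S])
    show "?S \<subseteq> carrier R" using xp by auto
    have "\<one> = \<one> \<otimes> x p [^] (0::nat)" by simp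
    then show "\<one> \<in> ?S" using one by blast
    show "v \<otimes> w \<in> ?S" if vw: "v \<in> ?S" "w \<in> ?S" for v w
    proof -
      obtain t n u m where v: "v = t \<otimes> x p [^] (n::nat)" "t \<in> carrier R - P"
        and w: "w = u \<otimes> x p [^] (m::nat)" "u \<in> carrier R - P"
        using vw by blast
      have "v \<otimes> w = (t \<otimes> u) \<otimes> x p [^] (n + m)"
        using v w xp by (simp add: nat_pow_mult[symmetric] m_ac)
      then show ?thesis using mult[OF v(2) w(2)] by blast
    qed
    show "?J \<inter> ?S = {}" using avoid by blast
  qed
  interpret Q: primeideal Q R by (rule Q(1))
  have QP: "Q \<subseteq> P"
  proof
    fix r assume r: "r \<in> Q"
    show "r \<in> P"
    proof (rule ccontr)
      assume "r \<notin> P"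
      moreover have "r = r \<otimes> x p [^] (0::nat)" using r Q.Icarr by simp
      ultimately have "r \<in> ?S" using r Q.Icarr by blast
      then show False using Q(3) r by blast
    qed
  qed
  have "x p \<notin> Q"
  proof -
    have "x p = \<one> \<otimes> x p [^] (1::nat)" using xp by simp
    then have "x p \<in> ?S" using one by blast
    then show ?thesis using Q(3) by blast
  qed
  moreover have "x p \<in> P" using insert.prems(2) by simp
  ultimately have strict: "Q \<subset> P" using QP by blast
  have "\<exists>s\<in>carrier R - P. \<forall>a\<in>syzygies R B x. (\<lambda>i. (s \<otimes> \<one>) \<otimes> a i) \<in> koszul_syzygies R B x"
  proof (rule koszul_nakayama[OF insert.prems(1) insert.hyps(1) xB one_closed])
    fix a assume a: "a \<in> syzygies R B x"
    have aR: "a i \<in> carrier R" for i using a by (auto simp: syzygies_def)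
    have "a(p := \<zero>) \<in> syzygies R (insert p B) x"
      by (rule syzygy_extend[OF insert.hyps xA a])
    then obtain s where s: "s \<in> carrier R - P"
        "(\<lambda>i. s \<otimes> (a(p := \<zero>)) i) \<in> koszul_syzygies R (insert p B) x"
      using insert.prems(3) by blast
    then obtain b k where b: "b \<in> syzygies R B x" and k: "k \<in> koszul_syzygies R B x"
      and eq: "\<forall>i. s \<otimes> a i = k i \<oplus> x p \<otimes> b i"
      using koszul_syzygy_restrict[OF insert.hyps xA _ a, of s] by blast
    have "b i \<in> carrier R" for i using b by (auto simp: syzygies_def)
    then have "\<forall>i. s \<otimes> (\<one> \<otimes> a i) = k i \<oplus> x p \<otimes> (\<one> \<otimes> b i)" using eq aR by simp
    then show "\<exists>s\<in>carrier R - P. \<exists>y\<in>P. \<exists>b\<in>syzygies R B x. \<exists>k\<in>koszul_syzygies R B x.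
        \<forall>i. s \<otimes> (\<one> \<otimes> a i) = k i \<oplus> y \<otimes> (\<one> \<otimes> b i)"
      using s(1) \<open>x p \<in> P\<close> b k by blast
  qed
  then obtain s where s: "s \<in> carrier R - P"
      "\<forall>a\<in>syzygies R B x. (\<lambda>i. (s \<otimes> \<one>) \<otimes> a i) \<in> koszul_syzygies R B x" by blast
  have "\<exists>C. prime_chain R (card B) C \<and> C (card B) = Q"
  proof (rule insert.IH[OF Q(1)])
    show "x \<in> B \<rightarrow> Q" using Q(2) genideal_self[of "x ` B"] xB unfolding J by auto
    show "\<exists>s\<in>carrier R - Q. (\<lambda>i. s \<otimes> a i) \<in> koszul_syzygies R B x"
      if "a \<in> syzygies R B x" for a
      using s that QP by (intro bexI[of _ s]) auto
  qed
  then obtain C where C: "prime_chain R (card B) C" "C (card B) = Q" by blast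
  have "prime_chain R (Suc (card B)) (C(Suc (card B) := P))"
    using prime_chain_append[OF C(1) insert.prems(1)] C(2) strict by simp
  then show ?case
    using insert.hyps by (intro exI[of _ "C(Suc (card B) := P)"]) (simp del: fun_upd_apply add: fun_upd_same)
qed

end

section \<open>Annihilators of the first Koszul homology\<close>

context cring
begin

lemma finsum_mem:
  assumes "finite B" "D \<subseteq> carrier R" "\<zero> \<in> D" "\<And>v w. v \<in> D \<Longrightarrow> w \<in> D \<Longrightarrow> v \<oplus> w \<in> D"
    and "\<And>i. i \<in> B \<Longrightarrow> f i \<in> D"
  shows "(\<Oplus>i\<in>B. f i) \<in> D"
  using assms(1,5)
proof (induction B)
  case (insert p B)
  then have "(\<Oplus>i\<in>insert p B. f i) = f p \<oplus> (\<Oplus>i\<in>B. f i)"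
    using assms(2) by (intro finsum_insert) auto
  then show ?case using insert assms(4) by simp
qed (use assms(3) in simp)

text \<open>Koszul homology in degree one, unwound: a syzygy \<open>a\<close> is the cycle \<open>f\<close> with \<open>f {i} = a i\<close>, and \<open>c f\<close> is
  a boundary. The alternating matrix comes from the coordinates \<open>g {i, j}\<close> of an element of degree
  two, with the sign of the differential.\<close>

lemma koszul_annihilator_syzygies:
  fixes xs :: "'a list"
  defines "n \<equiv> length xs"
  assumes xs: "set xs \<subseteq> carrier R" and c: "c \<in> carrier R"
    and ann: "annihilates c (koszul_homology R xs 1)"
    and a: "a \<in> syzygies R {..<n} ((!) xs)"
  shows "(\<lambda>i. c \<otimes> a i) \<in> koszul_syzygies R {..<n} ((!) xs)"
proof -
  have aR: "a i \<in> carrier R" for i using a by (auto simp: syzygies_def)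
  have xR: "xs ! i \<in> carrier R" if "i < n" for i using xs that by (auto simp: n_def)
  have index1: "{i} \<in> koszul_index n 1" if "i < n" for i using that by (auto simp: koszul_index_def)
  have index1E: "\<exists>i<n. S = {i}" if "S \<in> koszul_index n 1" for S
    using that by (auto simp: koszul_index_def card_1_singleton_iff)
  have index0: "koszul_index n 0 = {{}}"
    by (auto simp: koszul_index_def finite_subset[OF _ finite_lessThan])
  define f where "f = (\<lambda>S\<in>koszul_index n 1. a (the_elem S))"
  have f_carrier: "f \<in> koszul_index n 1 \<rightarrow>\<^sub>E carrier R"
    using aR by (auto simp: f_def)
  have f_single: "f {i} = a i" if "i < n" for i using index1[OF that] by (simp add: f_def)
  let ?N = "koszul_boundaries R xs 1"
  let ?M = "(koszul_module R n 1)\<lparr>carrier := koszul_cycles R xs 1\<rparr>"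
  have "koszul_diff R xs 0 f = \<zero>\<^bsub>koszul_module R n 0\<^esub>"
  proof -
    have "(\<Oplus>j\<in>{..<n} - {}. (\<ominus> \<one>) [^] card {k \<in> {}. k < j} \<otimes> (xs ! j) \<otimes> f (insert j {})) =
        linear_form R {..<n} ((!) xs) a"
      unfolding linear_form_def using aR xR f_single
      by (intro finsum_cong') (auto simp: m_comm)
    also have "\<dots> = \<zero>" using a by (simp add: syzygies_def)
    finally show ?thesis
      unfolding koszul_diff_def koszul_module_def n_def[symmetric] index0
      by (auto intro!: restrict_ext)
  qed
  then have f_cycle: "f \<in> koszul_cycles R xs 1"
    using f_carrier by (simp add: koszul_cycles_def koszul_module_def n_def)
  have zero_boundary: "\<zero>\<^bsub>?M\<^esub> \<in> ?N"
  proof -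
    let ?z = "\<lambda>S\<in>koszul_index n 2. \<zero>"
    have "?z \<in> carrier (koszul_module R n (Suc 1))"
      by (auto simp: koszul_module_def numeral_2_eq_2)
    moreover have "koszul_diff R xs 1 ?z = \<zero>\<^bsub>?M\<^esub>"
    proof -
      have "(\<Oplus>j\<in>{..<n} - T. (\<ominus> \<one>) [^] card {k \<in> T. k < j} \<otimes> (xs ! j) \<otimes> ?z (insert j T)) = \<zero>"
        if "T \<in> koszul_index n 1" for T
      proof (rule add.finprod_one_eqI)
        fix j assume j: "j \<in> {..<n} - T"
        then have "insert j T \<in> koszul_index n 2"
          using that by (auto simp: koszul_index_def card_1_singleton_iff)
        then show "(\<ominus> \<one>) [^] card {k \<in> T. k < j} \<otimes> (xs ! j) \<otimes> ?z (insert j T) = \<zero>"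
          using xR j by simp
      qed
      then show ?thesis
        unfolding koszul_diff_def n_def[symmetric] by (auto simp: koszul_module_def intro!: restrict_ext)
    qed
    ultimately show ?thesis unfolding koszul_boundaries_def n_def by (metis image_eqI)
  qed
  have zero_add: "\<zero>\<^bsub>?M\<^esub> \<oplus>\<^bsub>?M\<^esub> g = g" if "g \<in> koszul_index n 1 \<rightarrow>\<^sub>E carrier R" for g
    using that by (auto simp: koszul_module_def fun_eq_iff PiE_iff extensional_def)
  have coset_self: "g \<in> ?N +>\<^bsub>?M\<^esub> g" if "g \<in> koszul_index n 1 \<rightarrow>\<^sub>E carrier R" for g
    unfolding a_r_coset_def'
    by (rule UN_I[OF zero_boundary]) (simp only: zero_add[OF that] singleton_iff)
  let ?C = "?N +>\<^bsub>?M\<^esub> f"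
  have "?C \<in> carrier (koszul_homology R xs 1)"
    using f_cycle by (auto simp: koszul_homology_def quotient_module_def A_RCOSETS_def' n_def)
  then have "(\<Union>g\<in>?C. ?N +>\<^bsub>?M\<^esub> (c \<odot>\<^bsub>?M\<^esub> g)) = ?N"
    using ann unfolding annihilates_def koszul_homology_def quotient_module_def
    by (simp add: n_def)
  moreover have "f \<in> ?C" by (rule coset_self[OF f_carrier])
  ultimately have coset: "?N +>\<^bsub>?M\<^esub> (c \<odot>\<^bsub>?M\<^esub> f) \<subseteq> ?N" by blast
  have "c \<odot>\<^bsub>?M\<^esub> f \<in> koszul_index n 1 \<rightarrow>\<^sub>E carrier R"
    using f_carrier c by (auto simp: koszul_module_def)
  then have "c \<odot>\<^bsub>?M\<^esub> f \<in> ?N +>\<^bsub>?M\<^esub> (c \<odot>\<^bsub>?M\<^esub> f)"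
    by (rule coset_self)
  then have "c \<odot>\<^bsub>?M\<^esub> f \<in> ?N" using coset by blast
  then obtain g where g: "g \<in> koszul_index n 2 \<rightarrow>\<^sub>E carrier R"
      and cf: "c \<odot>\<^bsub>?M\<^esub> f = koszul_diff R xs 1 g"
    by (auto simp: koszul_boundaries_def koszul_module_def n_def numeral_2_eq_2)
  have gR: "g {i, j} \<in> carrier R" if "i < n" "j < n" "i \<noteq> j" for i j
    using that g by (intro PiE_mem[OF g]) (auto simp: koszul_index_def)
  define b where "b i j = (if i < n \<and> j < n \<and> i \<noteq> j
    then if i < j then \<ominus> g {i, j} else g {i, j} else \<zero>)" for i j
  have bR: "b i j \<in> carrier R" for i j using gR[of i j] by (simp add: b_def)
  have alt: "alternating R b"
  proof (rule alternatingI)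
    show "b i j = \<ominus> b j i" for i j
      using gR[of i j] by (cases i j rule: linorder_cases) (auto simp: b_def insert_commute)
  qed (use bR in \<open>auto simp: b_def\<close>)
  show ?thesis
  proof (rule koszul_syzygiesI[OF _ alt])
    show "(\<lambda>i. c \<otimes> a i) \<in> UNIV \<rightarrow> carrier R" using c aR by simp
    fix i assume "i \<in> {..<n}"
    then have i: "i < n" by simp
    have "c \<otimes> a i = (c \<odot>\<^bsub>?M\<^esub> f) {i}"
      using index1[OF i] f_single[OF i] by (simp add: koszul_module_def)
    also have "\<dots> = (\<Oplus>j\<in>{..<n} - {i}.
        (\<ominus> \<one>) [^] card {k \<in> {i}. k < j} \<otimes> (xs ! j) \<otimes> g (insert j {i}))"
      unfolding cf using index1[OF i] by (simp add: koszul_diff_def n_def)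
    also have "\<dots> = linear_form R ({..<n} - {i}) ((!) xs) (b i)"
      unfolding linear_form_def
    proof (rule finsum_cong'[OF refl])
      show "(\<lambda>j. b i j \<otimes> (xs ! j)) \<in> {..<n} - {i} \<rightarrow> carrier R" using bR xR by simp
      fix j assume j: "j \<in> {..<n} - {i}"
      have "{k \<in> {i}. k < j} = (if i < j then {i} else {})" by auto
      then have sign: "(\<ominus> \<one>) [^] card {k \<in> {i}. k < j} = (if i < j then \<ominus> \<one> else \<one>)"
        by (simp only: card.empty) simp
      show "(\<ominus> \<one>) [^] card {k \<in> {i}. k < j} \<otimes> (xs ! j) \<otimes> g (insert j {i}) =
          b i j \<otimes> (xs ! j)"
        unfolding sign using j i gR[of i j] xR[of j]
        by (simp add: b_def insert_commute l_minus m_comm[of "xs ! j"])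
    qed
    also have "\<dots> = b i i \<otimes> (xs ! i) \<oplus> linear_form R ({..<n} - {i}) ((!) xs) (b i)"
      using bR xR i linear_form_closed[of "(!) xs" "{..<n} - {i}" "b i"] alternatingD(2)[OF alt]
      by simp
    also have "\<dots> = linear_form R (insert i ({..<n} - {i})) ((!) xs) (b i)"
      using bR xR i by (intro linear_form_insert[symmetric]) auto
    also have "insert i ({..<n} - {i}) = {..<n}" using i by auto
    finally show "c \<otimes> a i = linear_form R {..<n} ((!) xs) (b i)" .
  qed
qed

end

context noetherian_local_ring
begin

lemma prime_maximal: "primeideal \<mm> R"
  by (rule maximalideal_prime[OF maximal])

lemma proper_ideal_subset_maximal:
  assumes "ideal J R" "J \<noteq> carrier R"
  shows "J \<subseteq> \<mm>"
proof -
  define \<phi> where "\<phi> L \<longleftrightarrow> ideal L R \<and> J \<subseteq> L \<and> L \<noteq> carrier R" for L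
  have "\<phi> J" using assms by (simp add: \<phi>_def)
  moreover have "\<And>L. \<phi> L \<Longrightarrow> ideal L R" by (simp add: \<phi>_def)
  ultimately obtain K where K: "\<phi> K" and max: "\<And>L. \<phi> L \<Longrightarrow> K \<subseteq> L \<Longrightarrow> L = K"
    using exists_maximal_ideal_with by blast
  have "maximalideal K R"
  proof (rule maximalidealI)
    show "L = K \<or> L = carrier R" if "ideal L R" "K \<subseteq> L" for L
      using max[of L] that K by (auto simp: \<phi>_def)
  qed (use K in \<open>auto simp: \<phi>_def\<close>)
  then show ?thesis using unique_maximal K by (auto simp: \<phi>_def)
qed

lemma invertible_outside_maximal:
  assumes "u \<in> carrier R" "u \<notin> \<mm>"
  obtains v where "v \<in> carrier R" "v \<otimes> u = \<one>"
proof -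
  note ad = ideal_adjoin[OF zeroideal assms(1)] adjoin_superset(2)[OF zeroideal assms(1)]
  have "adjoin R {\<zero>} u = carrier R"
    using proper_ideal_subset_maximal[OF ad(1)] ad(2) assms(2) by blast
  then have "\<one> \<in> adjoin R {\<zero>} u" by simp
  then obtain v where "v \<in> carrier R" "\<one> = \<zero> \<oplus> v \<otimes> u" unfolding adjoin_def by blast
  then show ?thesis using that assms(1) by simp
qed

lemma prime_over_primary:
  assumes "primary_to R \<mm> I" "primeideal p R" "I \<subseteq> p"
  shows "p = \<mm>"
proof
  interpret p: primeideal p R by fact
  show "p \<subseteq> \<mm>" using proper_ideal_subset_maximal[OF p.is_ideal] p.I_notcarr by blast
  show "\<mm> \<subseteq> p"
  proof
    fix r assume "r \<in> \<mm>"
    then obtain n :: nat where "r \<in> carrier R" "r [^] n \<in> I"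
      using assms(1) unfolding primary_to_def radical_def by blast
    then show "r \<in> p" using prime_radical[OF assms(2)] assms(3) by blast
  qed
qed

text \<open>The height theorem, applied to a smallest generating set, bounds every chain that ends in \<open>\<mm>\<close> by the
  least number of generators. A chain as long as a generating set attains this bound, so both
  numbers equal the height of \<open>\<mm>\<close>, which is the only prime over \<open>I\<close>.\<close>

lemma complete_intersection_of_chain:
  assumes I: "primary_to R \<mm> I" and A: "finite A" "A \<subseteq> carrier R" "I = Idl A"
    and C: "prime_chain R (card A) C" "C (card A) = \<mm>"
  shows "complete_intersection R I"
proof -
  let ?gens = "\<lambda>n. \<exists>A\<subseteq>carrier R. finite A \<and> card A = n \<and> I = Idl A"
  define N where "N = min_num_gens R I"
  have gens: "?gens (card A)" using A by blast
  have "?gens N" unfolding N_def min_num_gens_def by (rule LeastI[of ?gens, OF gens])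
  then obtain A0 where A0: "A0 \<subseteq> carrier R" "finite A0" "card A0 = N" "I = Idl A0" by blast
  have "N \<le> card A" unfolding N_def min_num_gens_def by (rule Least_le[of ?gens, OF gens])
  have I_ideal: "ideal I R" and I_sub: "I \<subseteq> \<mm>"
  proof -
    show "ideal I R" using I by (simp add: primary_to_def primary_ideal_def)
    then show "I \<subseteq> \<mm>"
      using proper_ideal_subset_maximal I by (auto simp: primary_to_def primary_ideal_def)
  qed
  have bound: "k \<le> N" if "prime_chain R k P" "P k = \<mm>" for k P
    unfolding A0(3)[symmetric]
  proof (rule prime_chain_length_le[OF A0(2) _ that(1)])
    show "A0 \<subseteq> P k" using genideal_self[OF A0(1)] A0(4) I_sub that(2) by blast
    show "Q = P k" if "primeideal Q R" "A0 \<subseteq> Q" for Q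
      using prime_over_primary[OF I that(1)] genideal_minimal[OF primeideal.axioms(1)[OF that(1)] that(2)]
        A0(4) \<open>P k = \<mm>\<close> by simp
  qed
  have "card A = N" using bound[OF C] \<open>N \<le> card A\<close> by simp
  have "prime_height R \<mm> = enat N"
    unfolding prime_height_def
  proof (rule antisym)
    show "Sup {enat n |n. \<exists>P. (\<forall>i\<le>n. primeideal (P i) R) \<and> (\<forall>i<n. P i \<subset> P (Suc i)) \<and> P n = \<mm>}
        \<le> enat N"
      using bound unfolding prime_chain_def by (intro Sup_least) auto
    show "enat N \<le>
        Sup {enat n |n. \<exists>P. (\<forall>i\<le>n. primeideal (P i) R) \<and> (\<forall>i<n. P i \<subset> P (Suc i)) \<and> P n = \<mm>}"
      using C \<open>card A = N\<close> unfolding prime_chain_def by (intro Sup_upper) blast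
  qed
  moreover have "{prime_height R p |p. primeideal p R \<and> I \<subseteq> p} = {prime_height R \<mm>}"
    using prime_over_primary[OF I] prime_maximal I_sub by blast
  ultimately show ?thesis
    by (simp add: complete_intersection_def ideal_height_def N_def)
qed

text \<open>The case where \<open>c y\<close> is a minimal generator of \<open>I\<close> for some \<open>y \<in> \<mm>\<close>. The generator \<open>x p\<close> can be
  exchanged for \<open>c y\<close>, so modulo the ideal \<open>J\<close> of the other generators \<open>x p\<close> may be read as \<open>c y\<close>. On the one hand,
  cancelling \<open>y\<close> from relations \<open>v c y \<in> J\<close> produces a prime \<open>P\<close> above \<open>J\<close> that contains neither \<open>y\<close>
  nor \<open>c\<close>. On the other hand, \<open>c\<close> kills the first Koszul homology of the other generators, by
  Nakayama's lemma with the factor \<open>y\<close>. Hence this homology vanishes at \<open>P\<close>.\<close>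

theorem complete_intersection_of_colon:
  assumes I: "primary_to R \<mm> I" and xs: "minimal_generators R I xs"
    and c: "c \<in> \<mm>" and ann: "annihilates c (koszul_homology R xs 1)"
    and y: "y \<in> \<mm>" and p: "p < length xs" and r: "r \<in> UNIV \<rightarrow> carrier R" "r p \<notin> \<mm>"
    and cy: "c \<otimes> y = linear_form R {..<length xs} ((!) xs) r"
  shows "complete_intersection R I"
proof -
  interpret m: primeideal \<mm> R by (rule prime_maximal)
  define x where "x = (!) xs"
  define B where "B = {..<length xs} - {p}"
  have A: "{..<length xs} = insert p B" using p by (auto simp: B_def)
  have B: "finite B" "p \<notin> B" by (auto simp: B_def)
  have xs': "distinct xs" "set xs \<subseteq> carrier R" "I = Idl (set xs)"
    "\<And>S. S \<subset> set xs \<Longrightarrow> I \<noteq> Idl S"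
    using xs by (auto simp: minimal_generators_def)
  have xA: "x \<in> insert p B \<rightarrow> carrier R"
    using xs'(2) unfolding A[symmetric] by (auto simp: x_def)
  then have xB: "x \<in> B \<rightarrow> carrier R" and xp: "x p \<in> carrier R" by auto
  have cR: "c \<in> carrier R" and yR: "y \<in> carrier R" using c y m.Icarr by auto
  define u where "u = r p"
  have uR: "u \<in> carrier R" and um: "u \<notin> \<mm>" using r by (auto simp: u_def)
  obtain u' where u': "u' \<in> carrier R" "u' \<otimes> u = \<one>"
    using invertible_outside_maximal[OF uR um] by blast
  define J where "J = span_ideal R B x"
  have J_Idl: "J = Idl (x ` B)" unfolding J_def by (rule span_ideal_eq_Idl[OF B(1) xB])
  interpret J: ideal J R unfolding J_Idl using xB by (intro genideal_ideal) auto
  define l where "l = linear_form R B x r"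
  have lJ: "l \<in> J" using r(1) by (auto simp: l_def J_def span_ideal_def)
  have lR: "l \<in> carrier R" using lJ J.Icarr by blast
  have cy': "c \<otimes> y = u \<otimes> x p \<oplus> l"
    unfolding cy A u_def l_def x_def[symmetric] using r by (intro linear_form_insert[OF B xA]) auto
  have ux: "u \<otimes> x p = c \<otimes> y \<oplus> \<ominus> l"
    unfolding cy' using uR xp lR by (simp add: a_assoc r_neg)
  have xpJ: "x p \<notin> J"
  proof
    assume "x p \<in> J"
    moreover have "x ` B \<subseteq> J" unfolding J_Idl using xB by (intro genideal_self) auto
    moreover have set_xs: "set xs = x ` insert p B"
      unfolding A[symmetric] x_def by (auto simp: set_conv_nth)
    ultimately have "set xs \<subseteq> J" by simp
    then have "I \<subseteq> J" unfolding xs'(3) by (rule genideal_minimal[OF J.is_ideal])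
    moreover have "J \<subseteq> I" unfolding J_Idl xs'(3)
      using xs'(2) set_xs by (intro subset_Idl_subset) auto
    moreover have "x ` B \<subset> set xs"
    proof -
      have "x p \<notin> x ` B"
        using xs'(1) p by (auto simp: x_def B_def nth_eq_iff_index_eq)
      then show ?thesis using set_xs by auto
    qed
    ultimately show False using xs'(4) J_Idl by blast
  qed
  have kos: "(\<lambda>i. c \<otimes> a i) \<in> koszul_syzygies R (insert p B) x" if "a \<in> syzygies R (insert p B) x" for a
    using koszul_annihilator_syzygies[OF xs'(2) cR ann] that unfolding A x_def by blast
  have cancel: "c \<otimes> v \<in> J" if v: "v \<in> carrier R" "c \<otimes> (v \<otimes> y) \<in> J" for v
  proof -
    have "(u \<otimes> v) \<otimes> x p = v \<otimes> (u \<otimes> x p)" using uR v xp by (simp add: m_ac)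
    also have "\<dots> = c \<otimes> (v \<otimes> y) \<oplus> v \<otimes> (\<ominus> l)"
      unfolding ux using v cR yR lR by (simp add: r_distr m_lcomm)
    also have "\<dots> \<in> J" by (intro J.a_closed v J.I_l_closed J.a_inv_closed lJ)
    finally have "\<exists>s\<in>{c}. s \<otimes> (u \<otimes> v) \<in> span_ideal R B x"
      using kos uR v by (intro koszul_syzygy_colon[OF B xA]) (auto simp: J_def)
    then have "u' \<otimes> (c \<otimes> (u \<otimes> v)) \<in> J" using u'(1) J.I_l_closed by (auto simp: J_def)
    moreover have "u' \<otimes> (c \<otimes> (u \<otimes> v)) = (u' \<otimes> u) \<otimes> (c \<otimes> v)"
      using u'(1) cR uR v by (simp add: m_ac)
    ultimately show ?thesis using u'(2) cR v by simp
  qed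
  have cJ: "c \<notin> J"
  proof
    assume "c \<in> J"
    then have "u \<otimes> x p \<in> J"
      unfolding ux by (intro J.a_closed J.I_r_closed J.a_inv_closed lJ yR)
    then have "u' \<otimes> (u \<otimes> x p) \<in> J" using u'(1) by (rule J.I_l_closed)
    then show False using u' uR xp xpJ by (simp add: m_assoc[symmetric])
  qed
  have yJ: "y [^] (k::nat) \<notin> J" for k
  proof
    have "c \<otimes> y [^] (k::nat) \<in> J \<Longrightarrow> c \<in> J" for k
    proof (induction k)
      case (Suc k)
      then show ?case using cancel[of "y [^] k"] yR by simp
    qed (use cR in simp)
    moreover assume "y [^] k \<in> J"
    then have "c \<otimes> y [^] k \<in> J" using cR by (rule J.I_l_closed)
    ultimately show False using cJ by blast
  qed
  obtain P where P: "primeideal P R" "J \<subseteq> P" "P \<inter> range (\<lambda>k::nat. y [^] k) = {}"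
  proof (rule exists_prime_avoiding[OF J.is_ideal, of "range (\<lambda>k::nat. y [^] k)"])
    have "\<one> = y [^] (0::nat)" by simp
    then show "\<one> \<in> range (\<lambda>k::nat. y [^] k)" by blast
    show "s \<otimes> t \<in> range (\<lambda>k::nat. y [^] k)"
      if "s \<in> range (\<lambda>k::nat. y [^] k)" "t \<in> range (\<lambda>k::nat. y [^] k)" for s t
      using that yR by (auto simp: nat_pow_mult)
  qed (use yR yJ in auto)
  interpret P: primeideal P R by (rule P(1))
  have Pm: "P \<subseteq> \<mm>" using proper_ideal_subset_maximal[OF P.is_ideal] P.I_notcarr by blast
  have "y = y [^] (1::nat)" using yR by simp
  then have yP: "y \<notin> P" using P(3) by blast
  have strict: "P \<subset> \<mm>" using Pm yP y by blast
  have cP: "c \<notin> P"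
  proof
    assume "c \<in> P"
    moreover have "l \<in> P" using lJ P(2) by blast
    ultimately have "u \<otimes> x p \<in> P"
      unfolding ux by (intro P.a_closed P.I_r_closed P.a_inv_closed yR)
    then have "x p \<in> P" using P.I_prime[OF uR xp] um Pm by blast
    moreover have "x ` B \<subseteq> P"
      using P(2) genideal_self[of "x ` B"] xB unfolding J_Idl by auto
    moreover have "set xs = x ` insert p B"
      unfolding A[symmetric] x_def by (auto simp: set_conv_nth)
    ultimately have "set xs \<subseteq> P" by simp
    then have "I \<subseteq> P" unfolding xs'(3) by (rule genideal_minimal[OF P.is_ideal])
    then show False using prime_over_primary[OF I P(1)] strict by blast
  qed
  \<comment> \<open>\<open>u c a = u x\<^sub>p b + u k = y c b - l b + u k\<close>, where \<open>l b\<close> is Koszul because \<open>l \<in> J\<close>\<close>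
  have "\<exists>s\<in>carrier R - \<mm>. \<forall>a\<in>syzygies R B x. (\<lambda>i. (s \<otimes> c) \<otimes> a i) \<in> koszul_syzygies R B x"
  proof (rule koszul_nakayama[OF prime_maximal B(1) xB cR])
    fix a assume a: "a \<in> syzygies R B x"
    have "(\<lambda>i. c \<otimes> (a(p := \<zero>)) i) \<in> koszul_syzygies R (insert p B) x"
      by (rule kos[OF syzygy_extend[OF B xA a]])
    then obtain b k where b: "b \<in> syzygies R B x" and k: "k \<in> koszul_syzygies R B x"
      and eq: "\<And>i. c \<otimes> a i = k i \<oplus> x p \<otimes> b i"
      using koszul_syzygy_restrict[OF B xA cR a] by blast
    have R: "a i \<in> carrier R" "b i \<in> carrier R" "k i \<in> carrier R" for i
      using a b k by (auto simp: syzygies_def koszul_syzygies_def)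
    define k' where "k' i = u \<otimes> k i \<oplus> (\<ominus> l) \<otimes> b i" for i
    note N = module.submoduleE[OF module_fun_module submodule_koszul_syzygies[OF B(1) xB]]
    have "(\<lambda>i. (\<ominus> l) \<otimes> b i) \<in> koszul_syzygies R B x"
      using J.a_inv_closed[OF lJ] unfolding J_def by (rule span_ideal_mult_syzygy[OF B(1) xB _ b])
    then have "k' \<in> koszul_syzygies R B x"
      using N(5)[OF N(4)[OF uR k]] by (simp add: k'_def[abs_def])
    moreover have "u \<otimes> (c \<otimes> a i) = k' i \<oplus> y \<otimes> (c \<otimes> b i)" for i
    proof -
      have "u \<otimes> (c \<otimes> a i) = u \<otimes> k i \<oplus> (u \<otimes> x p) \<otimes> b i"
        unfolding eq using R uR xp by (simp add: r_distr m_assoc)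
      also have "(u \<otimes> x p) \<otimes> b i = y \<otimes> (c \<otimes> b i) \<oplus> (\<ominus> l) \<otimes> b i"
        unfolding ux using R cR yR lR by (simp add: l_distr m_assoc m_lcomm[of y c])
      finally show ?thesis
        using R uR cR yR lR by (simp add: k'_def a_ac)
    qed
    ultimately show "\<exists>s\<in>carrier R - \<mm>. \<exists>y\<in>\<mm>. \<exists>b\<in>syzygies R B x. \<exists>k\<in>koszul_syzygies R B x.
        \<forall>i. s \<otimes> (c \<otimes> a i) = k i \<oplus> y \<otimes> (c \<otimes> b i)"
      using uR um y b by blast
  qed
  then obtain s where s: "s \<in> carrier R - \<mm>"
      "\<forall>a\<in>syzygies R B x. (\<lambda>i. (s \<otimes> c) \<otimes> a i) \<in> koszul_syzygies R B x" by blast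
  have "s \<otimes> c \<in> carrier R - P"
    using prime_complement_mult[OF P(1), of s c] s(1) Pm cR cP by blast
  moreover have "x \<in> B \<rightarrow> P"
    using P(2) genideal_self[of "x ` B"] xB unfolding J_Idl by auto
  ultimately obtain C where C: "prime_chain R (card B) C" "C (card B) = P"
    using prime_chain_of_locally_koszul[OF B(1) P(1), of x] s(2) by blast
  have "prime_chain R (Suc (card B)) (C(Suc (card B) := \<mm>))"
    using prime_chain_append[OF C(1) prime_maximal] C(2) strict by simp
  moreover have "card (set xs) = Suc (card B)"
    using distinct_card[OF xs'(1)] B A by (metis card_insert_disjoint card_lessThan)
  ultimately show ?thesis
    using complete_intersection_of_chain[OF I finite_set xs'(2,3), of "C(Suc (card B) := \<mm>)"]
    by (simp del: fun_upd_apply add: fun_upd_same)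
qed

end

theorem corollary2p4:
  fixes R :: "('a, 'b) ring_scheme" and \<mm> I :: "'a set" and xs :: "'a list" and c :: 'a
  assumes "noetherian_local_ring R \<mm>"
    and "primary_to R \<mm> I"
    and "\<not> complete_intersection R I"
    and "minimal_generators R I xs"
    and "c \<in> carrier R"
    and "annihilates c (koszul_homology R xs 1)"
    and "c \<in> colon_ideal R I \<mm>"
  shows "c \<in> integral_closure R I"
proof -
  interpret noetherian_local_ring R \<mm> by fact
  interpret m: primeideal \<mm> R by (rule prime_maximal)
  interpret M: module R "regular_module R" by (rule module_regular_module)
  let ?A = "{..<length xs}" and ?x = "(!) xs"
  have I_ideal: "ideal I R" and I_sub: "I \<subseteq> \<mm>"
    using assms(2) proper_ideal_subset_maximal[of I] by (auto simp: primary_to_def primary_ideal_def)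
  interpret I: ideal I R by (rule I_ideal)
  have xs: "distinct xs" "set xs \<subseteq> carrier R" "I = Idl\<^bsub>R\<^esub> (set xs)"
    using assms(4) by (auto simp: minimal_generators_def)
  have xR: "?x \<in> ?A \<rightarrow> carrier R" and x_image: "?x ` ?A = set xs"
    using xs(2) by (auto simp: set_conv_nth)
  have xI: "xs ! i \<in> I" if "i < length xs" for i
    using genideal_self[OF xs(2)] that unfolding xs(3) by auto
  have I_span: "I = span_ideal R ?A ?x"
    using span_ideal_eq_Idl[OF _ xR] x_image xs(3) by simp
  have "c \<in> \<mm>"
  proof (rule ccontr)
    assume "c \<notin> \<mm>"
    then have "\<exists>s\<in>carrier R - \<mm>. (\<lambda>i. s \<otimes>\<^bsub>R\<^esub> a i) \<in> koszul_syzygies R ?A ?x"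
      if "a \<in> syzygies R ?A ?x" for a
      using koszul_annihilator_syzygies[OF xs(2) assms(5,6) that] assms(5) by blast
    moreover have "?x \<in> ?A \<rightarrow> \<mm>" using xI I_sub by auto
    ultimately obtain C where "prime_chain R (card ?A) C" "C (card ?A) = \<mm>"
      using prime_chain_of_locally_koszul[OF _ prime_maximal, of ?A ?x] by blast
    then have "complete_intersection R I"
      using complete_intersection_of_chain[OF assms(2) finite_set xs(2,3)] distinct_card[OF xs(1)]
      by simp
    then show False using assms(3) by blast
  qed
  obtain gs where gs: "set gs \<subseteq> carrier R" "\<mm> = Idl\<^bsub>R\<^esub> (set gs)"
    using exists_generating_list[OF m.is_ideal] by blast
  have gsM: "set gs \<subseteq> carrier (regular_module R)" using gs(1) by simp
  have IR: "I \<subseteq> carrier R" using I.Icarr by blast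
  let ?D = "lin_combs (regular_module R) I gs"
  have D_add: "v \<oplus>\<^bsub>R\<^esub> w \<in> ?D" if "v \<in> ?D" "w \<in> ?D" for v w
    using M.lin_combs_add[OF IR gsM I.a_closed that] by simp
  have D_sub: "?D \<subseteq> carrier R" using M.lin_combs_closed[OF IR gsM] by simp
  have D_zero: "\<zero>\<^bsub>R\<^esub> \<in> ?D" using M.lin_combs_zero[OF I.zero_closed IR gsM] by simp
  \<comment> \<open>\<open>?D\<close> is the ideal \<open>I \<mm>\<close>\<close>
  have "\<forall>g\<in>set gs. c \<otimes>\<^bsub>R\<^esub> g \<in> ?D"
  proof (rule ccontr)
    assume "\<not> (\<forall>g\<in>set gs. c \<otimes>\<^bsub>R\<^esub> g \<in> ?D)"
    then obtain y where y: "y \<in> set gs" "c \<otimes>\<^bsub>R\<^esub> y \<notin> ?D" by blast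
    have ym: "y \<in> \<mm>" using genideal_self[OF gs(1)] gs(2) y(1) by blast
    then have "c \<otimes>\<^bsub>R\<^esub> y \<in> I" using assms(7) by (simp add: colon_ideal_def)
    then obtain r where r: "r \<in> UNIV \<rightarrow> carrier R" "c \<otimes>\<^bsub>R\<^esub> y = linear_form R ?A ?x r"
      unfolding I_span span_ideal_def by blast
    \<comment> \<open>otherwise \<open>c y = \<Sum> r\<^sub>i x\<^sub>i\<close> would lie in \<open>I \<mm>\<close>\<close>
    have "\<exists>p<length xs. r p \<notin> \<mm>"
    proof (rule ccontr)
      assume *: "\<not> (\<exists>p<length xs. r p \<notin> \<mm>)"
      have "(\<Oplus>\<^bsub>R\<^esub>i\<in>?A. r i \<otimes>\<^bsub>R\<^esub> xs ! i) \<in> ?D"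
      proof (rule finsum_mem[OF _ D_sub D_zero D_add])
        fix i assume i: "i \<in> ?A"
        then have "r i \<in> lin_combs (regular_module R) (carrier R) gs"
          using * gs lin_combs_regular_eq_Idl[OF gs(1)] by auto
        then have "(xs ! i) \<odot>\<^bsub>regular_module R\<^esub> r i \<in> ?D"
          using I.I_r_closed[OF xI] xI i IR by (intro M.lin_combs_smult[OF order_refl gsM]) auto
        then show "r i \<otimes>\<^bsub>R\<^esub> xs ! i \<in> ?D" using r(1) xR i by (simp add: m_comm)
      qed auto
      then show False using y(2) r(2) by (simp add: linear_form_def)
    qed
    then obtain p where "p < length xs" "r p \<notin> \<mm>" by blast
    then have "complete_intersection R I"
      using complete_intersection_of_colon[OF assms(2,4) \<open>c \<in> \<mm>\<close> assms(6) ym _ r(1) _ r(2)] by blast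
    then show False using assms(3) by blast
  qed
  then show ?thesis
    using integral_closureI[OF I_ideal assms(5) gs(1)] \<open>c \<in> \<mm>\<close> gs(2) by blast
qed

end
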